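(* Let $p\in(0,\infty)$ be fixed. For each $n$ let $N=N_n$ be a positive integer and $\epsilon=\epsilon_n>0$, and put $$u_n:=\frac{\epsilon_n^2\, n\, N_n^{3/2-2/p}}{\sqrt 2}.$$ Suppose that, as $n\to\infty$, $N_n\to\infty$, $N_n=o(n^2)$, $n=O(N_n)$, and $u_n\to u^*$ for some $u^*\in(0,\infty)$. Let $R^*=R^*_n$ be the minimax risk for testing uniformity of a multinomial distribution on $N_n$ categories from $n$ samples against $\ell_p$ departures of size at least $\epsilon_n$ (as defined in the context). Then $$\liminf_{n\to\infty} R^*_n \;\ge\; 2\,\Phi(-u^*/2).$$
   Context: $\Phi$ is the standard normal cumulative distribution function. For a probability vector $\mathbf q=(q_1,\dots,q_N)$, $H(\mathbf q)$ denotes the model $(O_1,\dots,O_N)\sim\mathrm{Mult}(n,\mathbf q)$ (the counts of $n$ independent samples from $\mathbf q$). Let $\mathbf q_{\mathrm{unif}}=(1/N,\dots,1/N)$ and $$A_N(\epsilon,p)=\{\mathbf q\in[0,1]^N:\ \|\mathbf q-\mathbf q_{\mathrm{unif}}\|_p\ge\epsilon,\ \|\mathbf q\|_1=1\},\qquad \|x\|_p=\Big(\sum_i|x_i|^p\Big)^{1/p}.$$ A test $\psi$ is a map from the observed counts $(O_1,\dots,O_N)$ to $\{0,1\}$. The minimax risk is $$R^*=\inf_\psi\Big(\Pr[\psi=1\mid H(\mathbf q_{\mathrm{unif}})]+\sup_{\mathbf q\in A_N(\epsilon,p)}\Pr[\psi=0\mid H(\mathbf q)]\Big).$$ *)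

theory Defs
  imports "HOL-Probability.Probability" "HOL-Library.Landau_Symbols"
begin

text \<open>Vectors in \<open>\<real>\<^sup>N\<close> are functions on the index set \<open>{..<N}\<close>, because the dimension
  varies with the sample size. Only the coordinates below \<open>N\<close> matter.\<close>

definition lp_norm :: "nat \<Rightarrow> real \<Rightarrow> (nat \<Rightarrow> real) \<Rightarrow> real" where
  "lp_norm N p x = (\<Sum>i<N. \<bar>x i\<bar> powr p) powr (1 / p)"

definition unif_vec :: "nat \<Rightarrow> nat \<Rightarrow> real" where
  "unif_vec N = (\<lambda>i\<in>{..<N}. 1 / real N)"

definition alternatives :: "nat \<Rightarrow> real \<Rightarrow> real \<Rightarrow> (nat \<Rightarrow> real) set" where
  "alternatives N \<epsilon> p =
     {q \<in> {..<N} \<rightarrow>\<^sub>E {0..1}. lp_norm N p (\<lambda>i. q i - unif_vec N i) \<ge> \<epsilon> \<and> lp_norm N 1 q = 1}"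

text \<open>The distribution of one sample from a probability vector \<open>q\<close>. The embedding is meaningful
  only if \<open>q\<close> is nonnegative and sums to one on \<open>{..<N}\<close>; see \<open>pmf_categorical\<close>.\<close>

definition categorical_pmf :: "nat \<Rightarrow> (nat \<Rightarrow> real) \<Rightarrow> nat pmf" where
  "categorical_pmf N q = embed_pmf (\<lambda>i. if i < N then q i else 0)"

lemma pmf_categorical:
  assumes nonneg: "\<And>i. i < N \<Longrightarrow> 0 \<le> q i" and sum1: "(\<Sum>i<N. q i) = 1"
  shows "pmf (categorical_pmf N q) i = (if i < N then q i else 0)"
  unfolding categorical_pmf_def
proof (rule pmf_embed_pmf)
  show "0 \<le> (if j < N then q j else 0)" for j
    using nonneg by simp
  have "(\<integral>\<^sup>+ j. ennreal (if j < N then q j else 0) \<partial>count_space UNIV) =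
        (\<Sum>j<N. ennreal (if j < N then q j else 0))"
    by (rule nn_integral_count_space') auto
  also have "\<dots> = (\<Sum>j<N. ennreal (q j))"
    by (intro sum.cong) auto
  also have "\<dots> = 1"
    using nonneg sum1 by (subst sum_ennreal) auto
  finally show "(\<integral>\<^sup>+ j. ennreal (if j < N then q j else 0) \<partial>count_space UNIV) = 1" .
qed

definition multinomial_pmf :: "nat \<Rightarrow> nat \<Rightarrow> (nat \<Rightarrow> real) \<Rightarrow> (nat \<Rightarrow> nat) pmf" where
  "multinomial_pmf n N q =
     map_pmf (\<lambda>xs. \<lambda>i\<in>{..<N}. count_list xs i) (replicate_pmf n (categorical_pmf N q))"

text \<open>Tests are the \<open>{0, 1}\<close>-valued functions of the vector of counts. Their values away from
  the vectors of counts that occur are irrelevant. The risk takes values in \<^typ>\<open>ennreal\<close>, where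
  the supremum over an empty set of alternatives is \<open>0\<close>.\<close>

definition test_risk :: "nat \<Rightarrow> nat \<Rightarrow> real \<Rightarrow> real \<Rightarrow> ((nat \<Rightarrow> nat) \<Rightarrow> nat) \<Rightarrow> ennreal" where
  "test_risk n N \<epsilon> p \<psi> =
     emeasure (multinomial_pmf n N (unif_vec N)) {c. \<psi> c = 1} +
     (SUP q \<in> alternatives N \<epsilon> p. emeasure (multinomial_pmf n N q) {c. \<psi> c = 0})"

definition minimax_risk :: "nat \<Rightarrow> nat \<Rightarrow> real \<Rightarrow> real \<Rightarrow> ennreal" where
  "minimax_risk n N \<epsilon> p = (INF \<psi> \<in> {\<psi>. range \<psi> \<subseteq> {0, 1}}. test_risk n N \<epsilon> p \<psi>)"

end

theory Submission
  imports Defs "HOL-Real_Asymp.Real_Asymp"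
begin

text \<open>The least favourable prior perturbs the uniform vector by independent random signs:
  \<open>q\<^sub>i = (1 + d s\<^sub>i) / (N w)\<close>, where \<open>w\<close> normalizes and \<open>d \<sim> \<epsilon> N\<^sup>1\<^sup>-\<^sup>1\<^sup>/\<^sup>p\<close>. If the number of
  observations is Poisson with a mean \<open>r\<close> slightly above \<open>n\<close>, the counts are independent Poisson
  variables with mean \<open>\<lambda> = r / N\<close> under the null hypothesis, and the likelihood ratio of the mixture
  is the product \<open>L\<close> of the factors
  \<open>\<ell>(O\<^sub>i) = ((1 + d)\<^bsup>O\<^sub>i\<^esup> exp(- \<lambda> d) + (1 - d)\<^bsup>O\<^sub>i\<^esup> exp(\<lambda> d)) / 2\<close>: giving the alternatives the total
  intensity \<open>r w\<close> cancels the normalization. The risk is at least \<open>E (min 1 L)\<close> up to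
  vanishing errors (too few observations, or an unbalanced sign vector). The variance of
  \<open>\<ell>(O\<^sub>i)\<close> is \<open>cosh (\<lambda> d\<^sup>2) - 1\<close>, which is asymptotic to \<open>u\<^sup>2 / N\<close>, so by a Lindeberg argument for
  characteristic functions \<open>ln L\<close> converges in law to \<open>N(- u\<^sup>2 / 2, u\<^sup>2)\<close>, under which
  \<open>min 1 (exp x)\<close> has expectation \<open>2 \<Phi>(- u / 2)\<close>.\<close>

section \<open>Poissonized samples and the independence of their counts\<close>

definition poisson_sample :: "real \<Rightarrow> 'a pmf \<Rightarrow> 'a list pmf" where
  "poisson_sample r p = poisson_pmf r \<bind> (\<lambda>m. replicate_pmf m p)"

lemma pmf_replicate_pmf:
  "pmf (replicate_pmf m p) xs = (if length xs = m then \<Prod>x\<leftarrow>xs. pmf p x else 0)"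
proof (induction m arbitrary: xs)
  case 0
  then show ?case by auto
next
  case (Suc m)
  have *: "replicate_pmf (Suc m) p = map_pmf (\<lambda>(x, xs). x # xs) (pair_pmf p (replicate_pmf m p))"
    by (simp add: pair_pmf_def map_bind_pmf)
  show ?case
  proof (cases xs)
    case Nil
    have "[] \<notin> set_pmf (replicate_pmf (Suc m) p)"
      by (auto simp: set_replicate_pmf simp del: replicate_pmf.simps)
    then show ?thesis using Nil by (simp add: pmf_eq_0_set_pmf del: replicate_pmf.simps)
  next
    case (Cons y ys)
    have "pmf (replicate_pmf (Suc m) p) xs = pmf p y * pmf (replicate_pmf m p) ys"
      using pmf_map_inj'[of "\<lambda>(x, xs). x # xs" "pair_pmf p (replicate_pmf m p)" "(y, ys)"]
      by (simp add: * Cons pmf_pair inj_def del: replicate_pmf.simps)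
    then show ?thesis using Suc.IH Cons by simp
  qed
qed

lemma pmf_poisson_sample:
  assumes "r > 0"
  shows "pmf (poisson_sample r p) xs =
    r ^ length xs / fact (length xs) * exp (- r) * (\<Prod>x\<leftarrow>xs. pmf p x)"
proof -
  have "pmf (poisson_sample r p) xs =
      (\<integral>m. (\<Prod>x\<leftarrow>xs. pmf p x) * indicator {length xs} m \<partial>poisson_pmf r)"
    unfolding poisson_sample_def pmf_bind pmf_replicate_pmf
    by (rule Bochner_Integration.integral_cong) (auto simp: indicator_def)
  then show ?thesis
    using assms by (simp add: measure_pmf_single)
qed

text \<open>The law of a Poissonized sample depends only on the intensities
  \<open>r * pmf p x\<close>. Passing to \<open>q\<close> with \<open>r * w\<close> in place of
  \<open>r\<close> multiplies them by \<open>g x\<close>: the factor \<open>w ^ length xs\<close>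
  from the Poisson weight absorbs the normalization of \<open>q\<close>. The density is therefore a
  product over the observations, up to the constant \<open>exp (r - r * w)\<close>.\<close>

lemma nn_integral_poisson_sample_tilt:
  assumes r: "r > 0" and w: "w > 0" and g: "\<And>x. g x \<ge> 0"
    and q: "\<And>x. w * pmf q x = g x * pmf p x"
  shows "(\<integral>\<^sup>+xs. f xs \<partial>poisson_sample (r * w) q) =
    (\<integral>\<^sup>+xs. ennreal (exp (r - r * w) * (\<Prod>x\<leftarrow>xs. g x)) * f xs \<partial>poisson_sample r p)"
proof -
  have *: "pmf (poisson_sample (r * w) q) xs =
      pmf (poisson_sample r p) xs * (exp (r - r * w) * (\<Prod>x\<leftarrow>xs. g x))" for xs
  proof -
    have "w ^ length xs * (\<Prod>x\<leftarrow>xs. pmf q x) = (\<Prod>x\<leftarrow>xs. g x) * (\<Prod>x\<leftarrow>xs. pmf p x)"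
    proof (induction xs)
      case (Cons a xs)
      have "w ^ length (a # xs) * (\<Prod>x\<leftarrow>a # xs. pmf q x)
        = (w * pmf q a) * (w ^ length xs * (\<Prod>x\<leftarrow>xs. pmf q x))" by simp
      then show ?case unfolding Cons.IH q by simp
    qed simp
    then have "r ^ length xs * (w ^ length xs * (\<Prod>x\<leftarrow>xs. pmf q x)) / fact (length xs) * exp (- (r * w)) =
      r ^ length xs * ((\<Prod>x\<leftarrow>xs. g x) * (\<Prod>x\<leftarrow>xs. pmf p x)) / fact (length xs)
        * (exp (r - r * w) * exp (- r))"
      by (simp flip: exp_add)
    then show ?thesis
      using r w by (simp add: pmf_poisson_sample power_mult_distrib mult_ac)
  qed
  have nn: "(\<Prod>x\<leftarrow>xs. g x) \<ge> 0" for xs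
    by (induction xs) (auto simp: g)
  show ?thesis
    unfolding nn_integral_measure_pmf *
    by (intro nn_integral_cong) (simp add: ennreal_mult nn mult_ac)
qed

text \<open>The multinomial formula, by induction on the sample size and conditioning on the first
  observation.\<close>

lemma pmf_map_count_list_replicate_pmf:
  assumes fin: "finite (set_pmf p)"
  shows "pmf (map_pmf count_list (replicate_pmf m p)) c =
    (if (\<forall>x. x \<notin> set_pmf p \<longrightarrow> c x = 0) \<and> (\<Sum>x\<in>set_pmf p. c x) = m
     then fact m * (\<Prod>x\<in>set_pmf p. pmf p x ^ c x / fact (c x)) else 0)"
proof (induction m arbitrary: c)
  case 0
  have "(\<forall>x. x \<notin> set_pmf p \<longrightarrow> c x = 0) \<and> (\<Sum>x\<in>set_pmf p. c x) = 0 \<longleftrightarrow> c = (\<lambda>_. 0)"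
    using fin by (auto simp: fun_eq_iff)
  moreover have "count_list [] = (\<lambda>_::'a. 0)" by auto
  ultimately show ?case by auto
next
  case (Suc m)
  let ?S = "set_pmf p"
  let ?D = "map_pmf count_list (replicate_pmf m p)"
  define inc where "inc x d = d(x := Suc (d x))" for x :: 'a and d :: "'a \<Rightarrow> nat"
  have cl: "count_list (x # xs) = inc x (count_list xs)" for x :: 'a and xs
    by (auto simp: inc_def)
  have inj: "inj (inc x)" for x
    by (rule injI) (auto simp: inc_def fun_eq_iff split: if_splits)
  have "map_pmf count_list (replicate_pmf (Suc m) p) = p \<bind> (\<lambda>x. map_pmf (inc x) ?D)"
    by (simp add: map_bind_pmf cl map_pmf_def bind_assoc_pmf bind_return_pmf)
  then have "pmf (map_pmf count_list (replicate_pmf (Suc m) p)) c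
      = (\<Sum>x\<in>?S. pmf p x * pmf (map_pmf (inc x) ?D) c)"
    by (simp add: pmf_bind integral_measure_pmf[OF fin] del: replicate_pmf.simps)
  also have "\<dots> = (\<Sum>x\<in>?S. pmf p x * (if c x > 0 then pmf ?D (c(x := c x - 1)) else 0))"
  proof (intro sum.cong refl arg_cong2[where f="(*)"])
    fix x assume "x \<in> ?S"
    show "pmf (map_pmf (inc x) ?D) c = (if c x > 0 then pmf ?D (c(x := c x - 1)) else 0)"
    proof (cases "c x > 0")
      case True
      then have "c = inc x (c(x := c x - 1))" by (auto simp: inc_def)
      then have "pmf (map_pmf (inc x) ?D) c = pmf (map_pmf (inc x) ?D) (inc x (c(x := c x - 1)))"
        by simp
      with True show ?thesis using pmf_map_inj'[OF inj] by simp
    next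
      case False
      then have "c \<notin> range (inc x)" by (auto simp: inc_def)
      then have "pmf (map_pmf (inc x) ?D) c = 0" by (subst pmf_eq_0_set_pmf) auto
      with False show ?thesis by simp
    qed
  qed
  also have "\<dots> = (if (\<forall>x. x \<notin> ?S \<longrightarrow> c x = 0) \<and> (\<Sum>x\<in>?S. c x) = Suc m
     then fact (Suc m) * (\<Prod>x\<in>?S. pmf p x ^ c x / fact (c x)) else 0)"
  proof (cases "(\<forall>x. x \<notin> ?S \<longrightarrow> c x = 0) \<and> (\<Sum>x\<in>?S. c x) = Suc m")
    case True
    \<comment> \<open>A first observation \<open>x\<close> contributes the share \<open>c x\<close>
      out of \<open>Suc m\<close> of the target, so summing over \<open>x\<close> produces the total
      count \<open>Suc m\<close> and turns \<open>fact m\<close> into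
      \<open>fact (Suc m)\<close>.\<close>
    have "pmf p x * (if c x > 0 then pmf ?D (c(x := c x - 1)) else 0)
        = fact m * real (c x) * (\<Prod>x\<in>?S. pmf p x ^ c x / fact (c x))" if x: "x \<in> ?S" for x
    proof (cases "c x > 0")
      case pos: True
      then obtain k where k: "c x = Suc k" by (cases "c x") auto
      have sum: "(\<Sum>y\<in>?S. (c(x := k)) y) = m"
        using True k sum.remove[OF fin x, of c] sum.remove[OF fin x, of "c(x := k)"] by simp
      have "pmf ?D (c(x := k)) = fact m * (\<Prod>y\<in>?S. pmf p y ^ (c(x := k)) y / fact ((c(x := k)) y))"
        unfolding Suc.IH using True x sum by auto
      also have "(\<Prod>y\<in>?S. pmf p y ^ (c(x := k)) y / fact ((c(x := k)) y))
        = pmf p x ^ k / fact k * (\<Prod>y\<in>?S - {x}. pmf p y ^ c y / fact (c y))"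
        by (subst prod.remove[OF fin x]) simp
      finally have D: "pmf ?D (c(x := k)) = fact m * (pmf p x ^ k / fact k *
        (\<Prod>y\<in>?S - {x}. pmf p y ^ c y / fact (c y)))" .
      have "pmf p x * (fact m * (pmf p x ^ k / fact k * R))
          = fact m * real (Suc k) * (pmf p x ^ Suc k / fact (Suc k) * R)" for R
        by (simp add: divide_simps del: of_nat_Suc)
      then show ?thesis
        unfolding prod.remove[OF fin x, of "\<lambda>x. pmf p x ^ c x / fact (c x)"] using k D
        by simp
    qed simp
    then have "(\<Sum>x\<in>?S. pmf p x * (if c x > 0 then pmf ?D (c(x := c x - 1)) else 0))
      = fact m * real (\<Sum>x\<in>?S. c x) * (\<Prod>x\<in>?S. pmf p x ^ c x / fact (c x))"
      by (simp add: sum_distrib_left sum_distrib_right)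
    with True show ?thesis by (simp add: mult_ac)
  next
    case False
    have "pmf p x * (if c x > 0 then pmf ?D (c(x := c x - 1)) else 0) = 0" if x: "x \<in> ?S" for x
    proof (cases "c x > 0")
      case pos: True
      then obtain k where k: "c x = Suc k" by (cases "c x") auto
      have "(\<Sum>y\<in>?S. c y) = Suc (\<Sum>y\<in>?S. (c(x := k)) y)"
        using k sum.remove[OF fin x, of c] sum.remove[OF fin x, of "c(x := k)"] by simp
      then have "\<not> ((\<forall>y. y \<notin> ?S \<longrightarrow> (c(x := k)) y = 0) \<and> (\<Sum>y\<in>?S. (c(x := k)) y) = m)"
        using False x by (auto split: if_splits)
      then have "pmf ?D (c(x := k)) = 0" unfolding Suc.IH by (rule if_not_P)
      with k show ?thesis by simp
    qed simp
    then have "(\<Sum>x\<in>?S. pmf p x * (if c x > 0 then pmf ?D (c(x := c x - 1)) else 0)) = 0"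
      by (intro sum.neutral ballI)
    then show ?thesis unfolding if_not_P[OF False] .
  qed
  finally show ?case .
qed

text \<open>Poisson splitting: the \<open>fact M\<close> of the multinomial formula cancels against
  the Poisson weight of the size \<open>M\<close>, and \<open>exp (- r)\<close> distributes over the
  points because the probabilities sum to one. What remains is a product over the points, so the
  counts are independent.\<close>

lemma map_count_list_poisson_sample:
  assumes fin: "finite (set_pmf p)" and r: "r > 0"
  shows "map_pmf count_list (poisson_sample r p) =
    Pi_pmf (set_pmf p) 0 (\<lambda>x. poisson_pmf (r * pmf p x))"
proof (rule pmf_eqI)
  fix c :: "'a \<Rightarrow> nat"
  let ?S = "set_pmf p"
  let ?P = "\<Prod>x\<in>?S. pmf p x ^ c x / fact (c x)"
  define M where "M = (\<Sum>x\<in>?S. c x)"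
  have "map_pmf count_list (poisson_sample r p)
      = poisson_pmf r \<bind> (\<lambda>m. map_pmf count_list (replicate_pmf m p))"
    unfolding poisson_sample_def map_bind_pmf ..
  then have "pmf (map_pmf count_list (poisson_sample r p)) c
      = (\<integral>m. pmf (map_pmf count_list (replicate_pmf m p)) c \<partial>poisson_pmf r)"
    by (simp only: pmf_bind)
  also have "\<dots> = (\<integral>m. (if \<forall>x. x \<notin> ?S \<longrightarrow> c x = 0 then fact M * ?P else 0) * indicator {M} m \<partial>poisson_pmf r)"
    unfolding pmf_map_count_list_replicate_pmf[OF fin] M_def
    by (intro Bochner_Integration.integral_cong) (auto simp: indicator_def)
  also have "\<dots> = (if \<forall>x. x \<notin> ?S \<longrightarrow> c x = 0 then r ^ M * exp (- r) * ?P else 0)"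
    using r by (cases "\<forall>x. x \<notin> ?S \<longrightarrow> c x = 0") (auto simp: measure_pmf_single)
  also have "\<dots> = pmf (Pi_pmf ?S 0 (\<lambda>x. poisson_pmf (r * pmf p x))) c"
  proof -
    have "(\<Prod>x\<in>?S. pmf (poisson_pmf (r * pmf p x)) (c x))
        = (\<Prod>x\<in>?S. r ^ c x * (pmf p x ^ c x / fact (c x)) * exp (- (r * pmf p x)))"
      using r by (intro prod.cong) (simp_all add: pmf_positive_iff power_mult_distrib)
    also have "\<dots> = r ^ M * ?P * exp (- (\<Sum>x\<in>?S. r * pmf p x))"
      unfolding prod.distrib M_def by (simp add: power_sum exp_sum fin prod_dividef flip: sum_negf)
    also have "(\<Sum>x\<in>?S. r * pmf p x) = r"
      using sum_pmf_eq_1[OF fin subset_refl] by (simp flip: sum_distrib_left)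
    finally show ?thesis by (subst pmf_Pi[OF fin]) (auto simp: mult_ac)
  qed
  finally show "pmf (map_pmf count_list (poisson_sample r p)) c
      = pmf (Pi_pmf ?S 0 (\<lambda>x. poisson_pmf (r * pmf p x))) c" .
qed

section \<open>Moments of the mixture likelihood ratio under a Poisson law\<close>

lemma
  fixes f :: "nat \<Rightarrow> real"
  assumes r: "r > 0" and f: "summable (\<lambda>k. r ^ k / fact k * \<bar>f k\<bar>)"
  shows integrable_poisson_pmf: "integrable (poisson_pmf r) f"
    and expectation_poisson_pmf:
      "measure_pmf.expectation (poisson_pmf r) f = exp (- r) * (\<Sum>k. r ^ k / fact k * f k)"
proof -
  have nn: "AE k in count_space UNIV. 0 \<le> pmf (poisson_pmf r) k" by simp
  have "summable (\<lambda>k. exp (- r) * (r ^ k / fact k * \<bar>f k\<bar>))"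
    by (intro summable_mult f)
  then have 1: "integrable (count_space UNIV) (\<lambda>k. pmf (poisson_pmf r) k *\<^sub>R f k)"
    unfolding integrable_count_space_nat_iff using r by (simp add: abs_mult mult_ac)
  then show "integrable (poisson_pmf r) f"
    unfolding measure_pmf_eq_density by (subst integrable_density) auto
  have "summable (\<lambda>k. r ^ k / fact k * f k)"
    by (rule summable_norm_cancel) (use f r in \<open>simp add: abs_mult\<close>)
  then have "(\<Sum>k. exp (- r) * (r ^ k / fact k * f k)) = exp (- r) * (\<Sum>k. r ^ k / fact k * f k)"
    by (rule suminf_mult)
  moreover have "measure_pmf.expectation (poisson_pmf r) f = (\<Sum>k. pmf (poisson_pmf r) k *\<^sub>R f k)"
    unfolding measure_pmf_eq_density using integral_count_space_nat[OF 1]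
    by (subst integral_density) auto
  ultimately show "measure_pmf.expectation (poisson_pmf r) f = exp (- r) * (\<Sum>k. r ^ k / fact k * f k)"
    using r by (simp add: mult_ac)
qed

text \<open>This is the probability generating function; the first two moments of
  \<open>mix_lr\<close> are linear combinations of its values.\<close>

lemma
  fixes r z :: real
  assumes r: "r > 0"
  shows integrable_poisson_power: "integrable (poisson_pmf r) (\<lambda>k. z ^ k)"
    and expectation_poisson_power:
      "measure_pmf.expectation (poisson_pmf r) (\<lambda>k. z ^ k) = exp (r * (z - 1))"
proof -
  have "summable (\<lambda>k. r ^ k / fact k * \<bar>z ^ k\<bar>)"
    using summable_exp[of "r * \<bar>z\<bar>"] by (simp add: power_mult_distrib power_abs field_simps)
  note * = integrable_poisson_pmf[OF r this] expectation_poisson_pmf[OF r this]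
  from *(1) show "integrable (poisson_pmf r) (\<lambda>k. z ^ k)" .
  have "(\<Sum>k. r ^ k / fact k * z ^ k) = exp (r * z)"
    by (simp add: exp_def power_mult_distrib divide_simps mult_ac)
  then show "measure_pmf.expectation (poisson_pmf r) (\<lambda>k. z ^ k) = exp (r * (z - 1))"
    unfolding *(2) by (simp add: algebra_simps flip: exp_add)
qed

text \<open>The likelihood ratio of the equal mixture of the Poisson laws with means
  \<open>r * (1 + d)\<close> and \<open>r * (1 - d)\<close> against the Poisson law with mean
  \<open>r\<close>.\<close>

definition mix_lr :: "real \<Rightarrow> real \<Rightarrow> nat \<Rightarrow> real" where
  "mix_lr r d k = ((1 + d) ^ k * exp (- (r * d)) + (1 - d) ^ k * exp (r * d)) / 2"

lemma mix_lr_pos: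
  assumes "0 \<le> d" "d < 1"
  shows "mix_lr r d k > 0"
  unfolding mix_lr_def using assms by (intro divide_pos_pos add_pos_pos mult_pos_pos) auto

lemma
  assumes r: "r > 0"
  shows integrable_mix_lr: "integrable (poisson_pmf r) (mix_lr r d)"
    and expectation_mix_lr: "measure_pmf.expectation (poisson_pmf r) (mix_lr r d) = 1"
  unfolding mix_lr_def using integrable_poisson_power[OF r] expectation_poisson_power[OF r]
  by (simp_all flip: exp_add)

text \<open>Expanding the square gives generating functions at (1 + d)^2, 1 - d^2 and (1 - d)^2. The
  two pure squares each yield \<open>exp (r * d\<^sup>2)\<close> and the cross term yields
  \<open>exp (- (r * d\<^sup>2))\<close> twice, which is a hyperbolic cosine after division by
  4.\<close>

lemma
  assumes r: "r > 0"
  shows integrable_mix_lr_square: "integrable (poisson_pmf r) (\<lambda>k. (mix_lr r d k)\<^sup>2)"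
    and expectation_mix_lr_square:
      "measure_pmf.expectation (poisson_pmf r) (\<lambda>k. (mix_lr r d k)\<^sup>2) = cosh (r * d\<^sup>2)"
proof -
  have eq: "(mix_lr r d k)\<^sup>2 = (((1 + d)\<^sup>2) ^ k * exp (- (2 * r * d)) + 2 * (1 - d\<^sup>2) ^ k
      + ((1 - d)\<^sup>2) ^ k * exp (2 * r * d)) / 4" for k
  proof -
    have 1: "exp (- (2 * r * d)) = (exp (- (r * d)))\<^sup>2" "exp (2 * r * d) = (exp (r * d))\<^sup>2"
      by (simp_all add: power2_eq_square flip: exp_add)
    have 2: "((1 + d)\<^sup>2) ^ k = ((1 + d) ^ k)\<^sup>2" "((1 - d)\<^sup>2) ^ k = ((1 - d) ^ k)\<^sup>2"
      by (simp_all add: mult.commute flip: power_mult)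
    have 3: "(1 - d\<^sup>2) ^ k = (1 + d) ^ k * (1 - d) ^ k"
      by (simp add: power2_eq_square algebra_simps flip: power_mult_distrib)
    have "exp (- (r * d)) * exp (r * d) = 1" by (simp flip: exp_add)
    then have "((a * e + b * f) / 2)\<^sup>2 = (a\<^sup>2 * e\<^sup>2 + 2 * (a * b) + b\<^sup>2 * f\<^sup>2) / 4"
      if "e = exp (- (r * d))" "f = exp (r * d)" for a b e f :: real
      unfolding that by (simp add: power_divide power2_sum power_mult_distrib mult_ac)
    then show ?thesis unfolding mix_lr_def 1 2 3 by simp
  qed
  show "integrable (poisson_pmf r) (\<lambda>k. (mix_lr r d k)\<^sup>2)"
    unfolding eq using integrable_poisson_power[OF r] by simp
  have "measure_pmf.expectation (poisson_pmf r) (\<lambda>k. (mix_lr r d k)\<^sup>2) =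
    (exp (r * ((1 + d)\<^sup>2 - 1)) * exp (- (2 * r * d)) + 2 * exp (r * ((1 - d\<^sup>2) - 1))
      + exp (r * ((1 - d)\<^sup>2 - 1)) * exp (2 * r * d)) / 4"
    unfolding eq using integrable_poisson_power[OF r] by (simp add: expectation_poisson_power[OF r])
  also have "\<dots> = (exp (r * d\<^sup>2) + 2 * exp (- (r * d\<^sup>2)) + exp (r * d\<^sup>2)) / 4"
    by (simp add: power2_eq_square algebra_simps flip: exp_add)
  also have "\<dots> = cosh (r * d\<^sup>2)" by (simp add: cosh_def)
  finally show "measure_pmf.expectation (poisson_pmf r) (\<lambda>k. (mix_lr r d k)\<^sup>2) = cosh (r * d\<^sup>2)" .
qed

lemma
  assumes r: "r > 0"
  shows integrable_mix_lr_centered_square: "integrable (poisson_pmf r) (\<lambda>k. (mix_lr r d k - 1)\<^sup>2)"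
    and expectation_mix_lr_centered_square:
      "measure_pmf.expectation (poisson_pmf r) (\<lambda>k. (mix_lr r d k - 1)\<^sup>2) = cosh (r * d\<^sup>2) - 1"
  unfolding power2_diff
  using integrable_mix_lr[OF r] integrable_mix_lr_square[OF r]
  by (simp_all add: expectation_mix_lr[OF r] expectation_mix_lr_square[OF r])

text \<open>\<open>mix_lr r d k\<close> averages \<open>g0 x = (1 + x) ^ k * exp (- (r * x))\<close>
  over x = d and x = -d, so the first-order terms cancel and only the second-order remainder,
  controlled by \<open>g2\<close>, is left. The last factor keeps the dependence on \<open>r\<close>
  explicit: it is quadratic in \<open>r\<close> for k = 0 and has no constant term for k =
  1.\<close>

lemma abs_mix_lr_minus_1_le:
  assumes r: "0 \<le> r" and d: "0 \<le> d" "d \<le> 1"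
  shows "\<bar>mix_lr r d k - 1\<bar> \<le> d\<^sup>2 * exp r * 2 ^ k * (real k * real (k - 1) + 2 * r * real k + r\<^sup>2)"
proof -
  define B where "B = exp r * 2 ^ k * (real k * real (k - 1) + 2 * r * real k + r\<^sup>2)"
  define g0 where "g0 x = (1 + x) ^ k * exp (- (r * x))" for x
  define g1 where "g1 x = exp (- (r * x)) * (real k * (1 + x) ^ (k - 1) - r * (1 + x) ^ k)" for x
  define g2 where "g2 x = exp (- (r * x)) * (real k * real (k - 1) * (1 + x) ^ (k - 2)
      - 2 * r * (real k * (1 + x) ^ (k - 1)) + r\<^sup>2 * (1 + x) ^ k)" for x
  have D0: "DERIV g0 x :> g1 x" for x
    unfolding g0_def g1_def by (auto intro!: derivative_eq_intros simp: algebra_simps)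
  have D1: "DERIV g1 x :> g2 x" for x
    unfolding g1_def g2_def
    by (auto intro!: derivative_eq_intros simp: algebra_simps power2_eq_square numeral_2_eq_2)
  define D where "D m = (if m = 0 then g0 else if m = 1 then g1 else g2)" for m :: nat
  have B2: "\<bar>g2 x\<bar> \<le> B" if "\<bar>x\<bar> \<le> 1" for x
  proof -
    have p: "(1 + x) ^ j \<le> 2 ^ k" "(1 + x) ^ j \<ge> 0" if "j \<le> k" for j
    proof -
      have "(1 + x) ^ j \<le> 2 ^ j" using \<open>\<bar>x\<bar> \<le> 1\<close> by (intro power_mono) auto
      also have "\<dots> \<le> 2 ^ k" using that by (intro power_increasing) auto
      finally show "(1 + x) ^ j \<le> 2 ^ k" .
      show "(1 + x) ^ j \<ge> 0" using \<open>\<bar>x\<bar> \<le> 1\<close> by (intro zero_le_power) auto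
    qed
    have "- (r * x) \<le> r"
      using mult_left_mono[of "-x" 1 r] that r by auto
    then have e: "exp (- (r * x)) \<le> exp r" by simp
    define A where "A = real k * real (k - 1) * (1 + x) ^ (k - 2)
      - 2 * r * (real k * (1 + x) ^ (k - 1)) + r\<^sup>2 * (1 + x) ^ k"
    have "\<bar>A\<bar> \<le> real k * real (k - 1) * (1 + x) ^ (k - 2)
      + 2 * r * (real k * (1 + x) ^ (k - 1)) + r\<^sup>2 * (1 + x) ^ k"
      unfolding A_def using r p by (simp add: abs_le_iff)
    also have "\<dots> \<le> real k * real (k - 1) * 2 ^ k + 2 * r * (real k * 2 ^ k) + r\<^sup>2 * 2 ^ k"
      using r p by (intro add_mono mult_left_mono) auto
    finally have "\<bar>A\<bar> \<le> 2 ^ k * (real k * real (k - 1) + 2 * r * real k + r\<^sup>2)"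
      by (simp add: algebra_simps)
    with e have "exp (- (r * x)) * \<bar>A\<bar> \<le> exp r * (2 ^ k * (real k * real (k - 1) + 2 * r * real k + r\<^sup>2))"
      by (intro mult_mono) auto
    then show ?thesis unfolding B_def g2_def A_def by (simp add: abs_mult mult.assoc)
  qed
  have T: "\<bar>g0 x - g0 0 - g1 0 * x\<bar> \<le> B / 2 * d\<^sup>2" if "\<bar>x\<bar> \<le> d" for x
  proof -
    have "\<forall>m t. m < 2 \<and> \<bar>t\<bar> \<le> \<bar>x\<bar> \<longrightarrow> DERIV (D m) t :> D (Suc m) t"
      using D0 D1 by (auto simp: D_def less_2_cases_iff)
    from Maclaurin_bi_le[of D g0 2 x, OF _ this] obtain t where t: "\<bar>t\<bar> \<le> \<bar>x\<bar>"
      and eq: "g0 x = (\<Sum>m<2. D m 0 / fact m * x ^ m) + D 2 t / fact 2 * x ^ 2"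
      by (auto simp: D_def)
    have "g0 x - g0 0 - g1 0 * x = g2 t / 2 * x\<^sup>2"
      using eq by (simp add: D_def numeral_2_eq_2)
    moreover have "\<bar>g2 t / 2 * x\<^sup>2\<bar> \<le> B / 2 * d\<^sup>2"
    proof -
      have "x\<^sup>2 \<le> d\<^sup>2" using that d by (simp add: abs_le_square_iff[symmetric])
      moreover have "\<bar>g2 t\<bar> \<le> B" using t that d by (intro B2) auto
      ultimately show ?thesis using mult_mono[of "\<bar>g2 t\<bar> / 2" "B / 2" "x\<^sup>2" "d\<^sup>2"]
        by (auto simp: abs_mult)
    qed
    ultimately show ?thesis by metis
  qed
  have "2 * (mix_lr r d k - 1) = (g0 d - g0 0 - g1 0 * d) + (g0 (- d) - g0 0 - g1 0 * (- d))"
    by (simp add: g0_def mix_lr_def)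
  then have "\<bar>2 * (mix_lr r d k - 1)\<bar> \<le> B / 2 * d\<^sup>2 + B / 2 * d\<^sup>2"
    using T[of d] T[of "- d"] d by linarith
  then have "2 * \<bar>mix_lr r d k - 1\<bar> \<le> B * d\<^sup>2" unfolding abs_mult by simp
  moreover have "B * d\<^sup>2 \<ge> 0" unfolding B_def using r by simp
  moreover have "a \<le> c" if "2 * a \<le> c" "c \<ge> 0" for a c :: real using that by linarith
  ultimately have "\<bar>mix_lr r d k - 1\<bar> \<le> B * d\<^sup>2" by blast
  then show ?thesis unfolding B_def by (simp add: mult_ac)
qed

text \<open>Since \<open>r\<close> may tend to \<open>0\<close>, the factor \<open>r\<^sup>2\<close> matters: for \<open>k = 0\<close> and \<open>k = 1\<close> it comes from
  the second-order smallness of \<open>mix_lr r d k - 1\<close>, for \<open>k \<ge> 2\<close> from the Poisson weight.\<close>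

lemma expectation_mix_lr_centered_cube:
  fixes R :: real
  assumes R: "R > 0"
  obtains C where "C > 0"
    "\<And>r d. 0 < r \<Longrightarrow> r \<le> R \<Longrightarrow> 0 \<le> d \<Longrightarrow> d \<le> 1 \<Longrightarrow>
      integrable (poisson_pmf r) (\<lambda>k. \<bar>mix_lr r d k - 1\<bar> ^ 3) \<and>
      measure_pmf.expectation (poisson_pmf r) (\<lambda>k. \<bar>mix_lr r d k - 1\<bar> ^ 3) \<le> C * d ^ 6 * r\<^sup>2"
proof -
  \<comment> \<open>Working with S \<ge> 1 allows powers of \<open>S\<close> to be enlarged freely.
    \<open>K\<close> is E^3 S^2, where \<open>E = exp S * 8 * S\<^sup>2\<close> is the constant in
    the bound \<open>y k \<le> d\<^sup>2 * (E * 8 ^ k)\<close> below, and 512 = 8^3 comes from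
    cubing that bound.\<close>
  define S where "S = max 1 R"
  define K where "K = (exp S * 8 * S\<^sup>2) ^ 3 * S\<^sup>2"
  have S1: "S \<ge> 1" "R \<le> S" by (auto simp: S_def)
  have K0: "K > 0" unfolding K_def using S1 by (intro mult_pos_pos zero_less_power) auto
  let ?C = "K * exp (S * 512)"
  have main: "integrable (poisson_pmf r) (\<lambda>k. \<bar>mix_lr r d k - 1\<bar> ^ 3) \<and>
      measure_pmf.expectation (poisson_pmf r) (\<lambda>k. \<bar>mix_lr r d k - 1\<bar> ^ 3) \<le> ?C * d ^ 6 * r\<^sup>2"
    if r: "0 < r" "r \<le> R" and d: "0 \<le> d" "d \<le> 1" for r d
  proof -
    have rS: "r \<le> S" using r S1 by simp
    define y where "y k = \<bar>mix_lr r d k - 1\<bar>" for k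
    have y0: "y k \<ge> 0" for k by (simp add: y_def)
    have eS: "exp r \<le> exp S" using rS by simp
    have crude: "real k * real (k - 1) + 2 * r * real k + r\<^sup>2 \<le> 8 * S\<^sup>2 * 4 ^ k" for k
    proof -
      have k2: "real k \<le> 2 ^ k" using of_nat_less_two_power[of k, where 'a=real] by linarith
      have "real (k - 1) \<le> 2 ^ k" using k2 by linarith
      then have "real k * real (k - 1) \<le> 2 ^ k * 2 ^ k" using k2 by (intro mult_mono) auto
      also have "\<dots> = 4 ^ k" by (simp flip: power_mult_distrib)
      also have "\<dots> \<le> S\<^sup>2 * 4 ^ k" using S1 by simp
      finally have 1: "real k * real (k - 1) \<le> S\<^sup>2 * 4 ^ k" .
      have k4: "real k \<le> 4 ^ k" using k2 power_mono[of 2 "4::real" k] by linarith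
      have "r * real k \<le> S\<^sup>2 * 4 ^ k"
        using k4 rS r S1 by (intro mult_mono) (auto intro: order_trans[OF _ self_le_power])
      then have 2: "2 * r * real k \<le> 2 * (S\<^sup>2 * 4 ^ k)" by simp
      have "r\<^sup>2 * 1 \<le> S\<^sup>2 * 4 ^ k" using rS r by (intro mult_mono power_mono) auto
      moreover have "S\<^sup>2 * 4 ^ k \<ge> 0" by simp
      ultimately show ?thesis using 1 2 by linarith
    qed
    have bnd: "r ^ k * y k ^ 3 \<le> K * d ^ 6 * r\<^sup>2 * (S * 512) ^ k" for k
    proof -
      have yk: "y k \<le> d\<^sup>2 * exp r * 2 ^ k * (real k * real (k - 1) + 2 * r * real k + r\<^sup>2)"
        unfolding y_def using abs_mix_lr_minus_1_le r d by simp
      define E where "E = exp S * 8 * S\<^sup>2"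
      have yE: "y k \<le> d\<^sup>2 * (E * 8 ^ k)"
      proof -
        have "y k \<le> d\<^sup>2 * exp S * 2 ^ k * (8 * S\<^sup>2 * 4 ^ k)"
          using r by (intro order_trans[OF yk] mult_mono eS crude) auto
        also have "\<dots> = d\<^sup>2 * (E * (2 ^ k * 4 ^ k))" by (simp add: E_def)
        finally show ?thesis by (simp flip: power_mult_distrib)
      qed
      have E0: "E > 0" unfolding E_def using S1 by auto
      have K: "K = E ^ 3 * S\<^sup>2" by (simp add: K_def E_def)
      \<comment> \<open>The product \<open>r ^ k * y k ^ 3\<close> is at most of order r^6 for k =
        0, r^4 for k = 1 and r^k for larger k. In each case two powers of \<open>r\<close> are kept
        and the surplus is estimated by r \<le> S.\<close>
      consider "k = 0" | "k = 1" | j where "k = j + 2"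
        by (metis One_nat_def Suc_1 add.commute add_2_eq_Suc' not0_implies_Suc)
      then show ?thesis
      proof cases
        case 1
        have "y k \<le> d\<^sup>2 * exp S * r\<^sup>2"           using yk 1 eS order_trans[OF _ mult_right_mono[OF mult_left_mono[OF eS], of "d\<^sup>2" "r\<^sup>2"]]
          by simp
        also have "\<dots> \<le> d\<^sup>2 * (E / S\<^sup>2) * r\<^sup>2" unfolding E_def using S1
          by (intro mult_right_mono mult_left_mono) auto
        finally have "y k ^ 3 \<le> (d\<^sup>2 * (E / S\<^sup>2) * r\<^sup>2) ^ 3" by (intro power_mono y0)
        also have "\<dots> = d ^ 6 * E ^ 3 * r\<^sup>2 * ((r / S) ^ 4 / S\<^sup>2)"
          using S1 by (simp add: power_mult_distrib power_divide field_simps flip: power_mult power_add)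
        also have "\<dots> \<le> d ^ 6 * E ^ 3 * r\<^sup>2 * S\<^sup>2"
        proof -
          have "(r / S) ^ 4 / S\<^sup>2 \<le> 1 / 1" using r rS S1 by (intro frac_le power_le_one) auto
          also have "1 / 1 \<le> S\<^sup>2" using S1 by simp
          finally show ?thesis using E0 by (intro mult_left_mono) auto
        qed
        finally show ?thesis using 1 K by (simp add: mult_ac)
      next
        case 2
        have "y k \<le> d\<^sup>2 * exp r * 2 * (2 * r + r\<^sup>2)" using yk 2 by simp
        also have "\<dots> \<le> d\<^sup>2 * exp S * 2 * (3 * S * r)"
        proof (intro mult_mono eS)
          have "r * r \<le> S * r" "1 * r \<le> S * r" using r rS S1 by (auto intro: mult_right_mono)
          then show "2 * r + r\<^sup>2 \<le> 3 * S * r" unfolding power2_eq_square by linarith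
        qed (use r S1 in auto)
        also have "\<dots> = d\<^sup>2 * (6 / (8 * S) * E) * r" unfolding E_def using S1
          by (simp add: power2_eq_square)
        also have "\<dots> \<le> d\<^sup>2 * (1 * E) * r" using S1 E0 r
          by (intro mult_mono) auto
        finally have "y k ^ 3 \<le> (d\<^sup>2 * (1 * E) * r) ^ 3" by (intro power_mono y0)
        then have "r ^ k * y k ^ 3 \<le> S * (d\<^sup>2 * (1 * E) * r) ^ 3"
          using 2 r rS y0[of k] by (intro mult_mono) auto
        also have "\<dots> = d ^ 6 * E ^ 3 * r\<^sup>2 * (S * r)"
          by (simp add: power_mult_distrib power3_eq_cube power2_eq_square flip: power_mult)
            (simp add: eval_nat_numeral mult_ac)
        also have "\<dots> \<le> d ^ 6 * E ^ 3 * r\<^sup>2 * (S\<^sup>2 * (S * 512))"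
        proof (intro mult_left_mono)
          have "S * r \<le> S\<^sup>2" using rS S1 by (simp add: power2_eq_square)
          also have "S\<^sup>2 * 1 \<le> S\<^sup>2 * (S * 512)" using S1 by (intro mult_left_mono) auto
          finally show "S * r \<le> S\<^sup>2 * (S * 512)" by simp
        qed (use E0 in auto)
        finally show ?thesis using 2 K by (simp add: mult_ac)
      next
        case 3
        have "r ^ k = r\<^sup>2 * r ^ j" by (simp add: 3 power2_eq_square)
        also have "\<dots> \<le> r\<^sup>2 * S ^ j" using r rS by (intro mult_left_mono power_mono) auto
        finally have "r ^ k * y k ^ 3 \<le> (r\<^sup>2 * S ^ j) * (d\<^sup>2 * (E * 8 ^ k)) ^ 3"
          using r S1 y0 by (intro mult_mono power_mono yE) auto
        also have "\<dots> = d ^ 6 * E ^ 3 * r\<^sup>2 * (S ^ j * (8 ^ k) ^ 3)"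
          by (simp add: power_mult_distrib flip: power_mult)
        finally have *: "r ^ k * y k ^ 3 \<le> d ^ 6 * E ^ 3 * r\<^sup>2 * (S ^ j * (8 ^ k) ^ 3)" .
        have "S ^ j * (8 ^ k) ^ 3 \<le> S ^ k * (8 ^ k) ^ 3"
          using S1 3 by (intro mult_right_mono power_increasing) auto
        also have "\<dots> = (S * 512) ^ k"
        proof -
          have "((8::real) ^ k) ^ 3 = (8 ^ 3) ^ k" by (metis power_mult mult.commute)
          then show ?thesis by (simp add: power_mult_distrib)
        qed
        also have "\<dots> \<le> S\<^sup>2 * (S * 512) ^ k" using S1 by simp
        finally have "d ^ 6 * E ^ 3 * r\<^sup>2 * (S ^ j * (8 ^ k) ^ 3)
            \<le> d ^ 6 * E ^ 3 * r\<^sup>2 * (S\<^sup>2 * (S * 512) ^ k)"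
          using E0 by (intro mult_left_mono) auto
        with * show ?thesis using K by (simp add: mult_ac)
      qed
    qed
    have bnd': "r ^ k / fact k * y k ^ 3 \<le> K * d ^ 6 * r\<^sup>2 * ((S * 512) ^ k / fact k)" for k
      using bnd[of k] by (simp add: divide_right_mono)
    have sm: "summable (\<lambda>k. K * d ^ 6 * r\<^sup>2 * ((S * 512) ^ k / fact k))"
      using summable_exp[of "S * 512"] by (intro summable_mult) (simp add: divide_inverse mult.commute)
    have s: "summable (\<lambda>k. r ^ k / fact k * \<bar>y k ^ 3\<bar>)"
      by (rule summable_comparison_test[OF _ sm]) (use bnd' r y0 in \<open>auto simp: abs_mult\<close>)
    have s': "summable (\<lambda>k. r ^ k / fact k * y k ^ 3)" using s y0 by simp
    have "(\<Sum>k. r ^ k / fact k * y k ^ 3) \<le> (\<Sum>k. K * d ^ 6 * r\<^sup>2 * ((S * 512) ^ k / fact k))"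
      by (intro suminf_le bnd' s' sm)
    also have "\<dots> = K * d ^ 6 * r\<^sup>2 * exp (S * 512)"
      unfolding exp_def using summable_exp[of "S * 512"]
      by (subst suminf_mult[symmetric]) (auto simp: divide_inverse mult_ac)
    finally have le: "(\<Sum>k. r ^ k / fact k * y k ^ 3) \<le> K * d ^ 6 * r\<^sup>2 * exp (S * 512)" .
    have "exp (- r) * (\<Sum>k. r ^ k / fact k * y k ^ 3) \<le> 1 * (K * d ^ 6 * r\<^sup>2 * exp (S * 512))"
      using r y0 K0 by (intro mult_mono le suminf_nonneg s') auto
    then show ?thesis
      using integrable_poisson_pmf[OF r(1) s] expectation_poisson_pmf[OF r(1) s]
      unfolding y_def by (simp add: mult_ac)
  qed
  show thesis by (rule that[of ?C]) (use main K0 in auto)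
qed

section \<open>Third-order expansion of powers with imaginary exponent\<close>

text \<open>The derivative of the remainder is x^2 / (1 + x), which is at most 2 y^2 on the segment
  from 0 to y.\<close>

lemma abs_ln_one_plus_x_order3:
  fixes y :: real
  assumes "\<bar>y\<bar> \<le> 1 / 2"
  shows "\<bar>ln (1 + y) - y + y\<^sup>2 / 2\<bar> \<le> 2 * \<bar>y\<bar> ^ 3"
proof -
  define f where "f x = ln (1 + x) - x + x\<^sup>2 / 2" for x :: real
  define f' where "f' x = x\<^sup>2 / (1 + x)" for x :: real
  have "norm (f y - f 0) \<le> 2 * y\<^sup>2 * norm (y - 0)"
  proof (rule field_differentiable_bound[of "closed_segment 0 y" f f'])
    fix x assume x: "x \<in> closed_segment 0 y"
    have xy: "\<bar>x\<bar> \<le> \<bar>y\<bar>" using segment_bound1[OF x] by simp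
    then have x2: "\<bar>x\<bar> \<le> 1 / 2" using assms by simp
    show "(f has_field_derivative f' x) (at x within closed_segment 0 y)"
      unfolding f_def f'_def using x2
      by (auto intro!: derivative_eq_intros simp: divide_simps power2_eq_square algebra_simps)
    have "x\<^sup>2 / (1 + x) \<le> y\<^sup>2 / (1 / 2)"
      using xy x2 by (intro frac_le) (auto simp: abs_le_square_iff[symmetric])
    then show "norm (f' x) \<le> 2 * y\<^sup>2" unfolding f'_def using x2 by simp
  qed auto
  then show ?thesis by (simp add: f_def power2_eq_square power3_eq_cube)
qed

lemma iexp_ln_approx:
  fixes t y :: real
  assumes y: "y > -1"
  shows "cmod (iexp (t * ln (1 + y)) - (1 + \<i> * t * y + \<i> * t * (\<i> * t - 1) / 2 * y\<^sup>2))
    \<le> (16 + 5 * \<bar>t\<bar> + 3 * t\<^sup>2 + 2 * \<bar>t\<bar> ^ 3) * \<bar>y\<bar> ^ 3"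
proof (cases "\<bar>y\<bar> \<le> 1 / 2")
  case True
  define x where "x = ln (1 + y)"
  have a: "\<bar>x - y\<bar> \<le> 2 * y\<^sup>2" unfolding x_def by (rule abs_ln_one_plus_x_minus_x_bound[OF True])
  have b: "\<bar>x - y + y\<^sup>2 / 2\<bar> \<le> 2 * \<bar>y\<bar> ^ 3" unfolding x_def by (rule abs_ln_one_plus_x_order3[OF True])
  have "y\<^sup>2 \<le> \<bar>y\<bar> * (1 / 2)"
    using mult_left_mono[OF True, of "\<bar>y\<bar>"] by (simp add: power2_eq_square abs_mult_self_eq)
  then have x2: "\<bar>x\<bar> \<le> 2 * \<bar>y\<bar>" using a by linarith
  have c: "\<bar>x\<^sup>2 - y\<^sup>2\<bar> \<le> 6 * \<bar>y\<bar> ^ 3"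
  proof -
    have "\<bar>x\<^sup>2 - y\<^sup>2\<bar> = \<bar>x - y\<bar> * \<bar>x + y\<bar>"
      by (simp add: power2_eq_square algebra_simps flip: abs_mult)
    also have "\<dots> \<le> (2 * y\<^sup>2) * (3 * \<bar>y\<bar>)" using a x2 by (intro mult_mono) auto
    also have "\<dots> = 6 * \<bar>y\<bar> ^ 3" by (simp add: power3_eq_cube power2_eq_square)
    finally show ?thesis .
  qed
  have d: "cmod (iexp (t * x) - (1 + \<i> * t * x - (t * x)\<^sup>2 / 2)) \<le> 2 * \<bar>t\<bar> ^ 3 * \<bar>y\<bar> ^ 3"
  proof -
    have "cmod (iexp (t * x) - (\<Sum>k\<le>2. (\<i> * of_real (t * x)) ^ k / fact k)) \<le> \<bar>t * x\<bar> ^ Suc 2 / fact (Suc 2)"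
      by (rule iexp_approx1)
    also have "(\<Sum>k\<le>2. (\<i> * of_real (t * x)) ^ k / fact k) = 1 + \<i> * t * x - (t * x)\<^sup>2 / 2"
    proof -
      have "(\<Sum>k\<le>2. z ^ k / fact k) = 1 + z + z\<^sup>2 / 2" for z :: complex
        by (simp add: numeral_2_eq_2)
      moreover have "(\<i> * of_real (t * x))\<^sup>2 = - (of_real ((t * x)\<^sup>2) :: complex)"
        by (simp add: power_mult_distrib)
      ultimately show ?thesis by simp
    qed
    also have "\<bar>t * x\<bar> ^ Suc 2 / fact (Suc 2) = \<bar>t\<bar> ^ 3 * \<bar>x\<bar> ^ 3 / 6"
    proof -
      have "\<bar>t * x\<bar> ^ Suc 2 = \<bar>t\<bar> ^ 3 * \<bar>x\<bar> ^ 3"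
        by (simp only: abs_mult power_mult_distrib eval_nat_numeral)
      moreover have "fact (Suc 2) = (6::real)" by (simp add: fact_numeral)
      ultimately show ?thesis by simp
    qed
    also have "\<dots> \<le> \<bar>t\<bar> ^ 3 * (2 * \<bar>y\<bar>) ^ 3 / 6"
      using x2 by (intro divide_right_mono mult_left_mono power_mono) auto
    also have "\<dots> \<le> 2 * \<bar>t\<bar> ^ 3 * \<bar>y\<bar> ^ 3" by (simp add: power_mult_distrib)
    finally show ?thesis .
  qed
  \<comment> \<open>The error splits into the Taylor remainder of the exponential, the remainder of
    the logarithm in the linear term, and the replacement of x^2 by y^2 in the quadratic term; these
    are bounded by \<open>d\<close>, \<open>b\<close> and \<open>c\<close>.\<close>
  have "iexp (t * x) - (1 + \<i> * t * y + \<i> * t * (\<i> * t - 1) / 2 * y\<^sup>2)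
    = (iexp (t * x) - (1 + \<i> * t * x - (t * x)\<^sup>2 / 2)) + \<i> * t * (x - y + y\<^sup>2 / 2) - t\<^sup>2 / 2 * (x\<^sup>2 - y\<^sup>2)"
    by (simp add: algebra_simps power2_eq_square diff_divide_distrib add_divide_distrib)
  also have "cmod \<dots> \<le> cmod (iexp (t * x) - (1 + \<i> * t * x - (t * x)\<^sup>2 / 2))
      + cmod (\<i> * t * (x - y + y\<^sup>2 / 2)) + cmod (t\<^sup>2 / 2 * (x\<^sup>2 - y\<^sup>2))"
    by (rule order_trans[OF norm_triangle_ineq4 add_right_mono[OF norm_triangle_ineq]])
  also have "cmod (\<i> * t * (x - y + y\<^sup>2 / 2)) = \<bar>t\<bar> * \<bar>x - y + y\<^sup>2 / 2\<bar>"
  proof -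
    have "\<i> * t * (x - y + y\<^sup>2 / 2) = \<i> * of_real (t * (x - y + y\<^sup>2 / 2))" by simp
    then show ?thesis by (simp only: norm_mult norm_ii norm_of_real abs_mult)
  qed
  also have "cmod (t\<^sup>2 / 2 * (x\<^sup>2 - y\<^sup>2)) = t\<^sup>2 / 2 * \<bar>x\<^sup>2 - y\<^sup>2\<bar>"
  proof -
    have "(of_real t)\<^sup>2 / 2 * ((of_real x)\<^sup>2 - (of_real y)\<^sup>2) = (of_real (t\<^sup>2 / 2 * (x\<^sup>2 - y\<^sup>2)) :: complex)" by simp
    then show ?thesis by (simp only: norm_of_real abs_mult) simp
  qed
  finally have "cmod (iexp (t * x) - (1 + \<i> * t * y + \<i> * t * (\<i> * t - 1) / 2 * y\<^sup>2))
    \<le> 2 * \<bar>t\<bar> ^ 3 * \<bar>y\<bar> ^ 3 + \<bar>t\<bar> * (2 * \<bar>y\<bar> ^ 3) + t\<^sup>2 / 2 * (6 * \<bar>y\<bar> ^ 3)"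
    by (rule order_trans) (intro add_mono d mult_left_mono b c; simp)
  also have "\<dots> = (0 + 2 * \<bar>t\<bar> + 3 * t\<^sup>2 + 2 * \<bar>t\<bar> ^ 3) * \<bar>y\<bar> ^ 3" by (simp add: algebra_simps)
  also have "\<dots> \<le> (16 + 5 * \<bar>t\<bar> + 3 * t\<^sup>2 + 2 * \<bar>t\<bar> ^ 3) * \<bar>y\<bar> ^ 3"
    by (intro mult_right_mono) auto
  finally show ?thesis unfolding x_def .
next
  case False
  then have z: "1 / 2 \<le> \<bar>y\<bar>" by simp
  have 0: "1 \<le> 8 * \<bar>y\<bar> ^ 3" using power_mono[OF z, of 3] by (simp add: power_divide)
  have 1: "\<bar>y\<bar> \<le> 4 * \<bar>y\<bar> ^ 3"
    using mult_left_mono[OF power_mono[OF z, of 2], of "\<bar>y\<bar>"]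
    by (simp add: power_divide power3_eq_cube power2_eq_square)
  have 2: "y\<^sup>2 \<le> 2 * \<bar>y\<bar> ^ 3"
    using mult_left_mono[OF z, of "y\<^sup>2"] by (simp add: power3_eq_cube power2_eq_square)
  have eq: "cmod (\<i> * t * y) = \<bar>t\<bar> * \<bar>y\<bar>" by (simp add: norm_mult)
  have eq2: "cmod (\<i> * t * (\<i> * t - 1) / 2 * y\<^sup>2) \<le> \<bar>t\<bar> * (\<bar>t\<bar> + 1) / 2 * y\<^sup>2"
  proof -
    have "cmod (\<i> * t - 1) \<le> \<bar>t\<bar> + 1" using norm_triangle_ineq4[of "\<i> * t" 1] by (simp add: norm_mult)
    then show ?thesis
      by (simp add: norm_mult norm_divide norm_power mult_left_mono mult_right_mono divide_right_mono)
  qed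
  have "cmod (iexp (t * ln (1 + y)) - (1 + \<i> * t * y + \<i> * t * (\<i> * t - 1) / 2 * y\<^sup>2))
    \<le> cmod (iexp (t * ln (1 + y))) + (cmod 1 + cmod (\<i> * t * y) + cmod (\<i> * t * (\<i> * t - 1) / 2 * y\<^sup>2))"
    by (intro order_trans[OF norm_triangle_ineq4] add_left_mono order_trans[OF norm_triangle_ineq]
        add_right_mono norm_triangle_ineq)
  also have "\<dots> \<le> 1 + (1 + \<bar>t\<bar> * \<bar>y\<bar> + \<bar>t\<bar> * (\<bar>t\<bar> + 1) / 2 * y\<^sup>2)"
    unfolding eq using eq2 by simp
  also have "\<dots> \<le> 8 * \<bar>y\<bar> ^ 3 + (8 * \<bar>y\<bar> ^ 3 + \<bar>t\<bar> * (4 * \<bar>y\<bar> ^ 3) + \<bar>t\<bar> * (\<bar>t\<bar> + 1) / 2 * (2 * \<bar>y\<bar> ^ 3))"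
    by (intro add_mono 0 mult_left_mono 1 2) auto
  also have "\<dots> = (16 + 5 * \<bar>t\<bar> + t\<^sup>2) * \<bar>y\<bar> ^ 3"
    by (simp add: algebra_simps power2_eq_square add_divide_distrib)
  also have "\<dots> \<le> (16 + 5 * \<bar>t\<bar> + 3 * t\<^sup>2 + 2 * \<bar>t\<bar> ^ 3) * \<bar>y\<bar> ^ 3"
    by (intro mult_right_mono) auto
  finally show ?thesis .
qed


section \<open>The normal limit law\<close>

lemma real_distribution_shifted_normal:
  "real_distribution (distr std_normal_distribution borel (\<lambda>z. v * z - v\<^sup>2 / 2))"
proof -
  interpret S: real_distribution std_normal_distribution by (rule real_dist_normal_dist)
  show ?thesis by (intro S.real_distribution_distr) auto
qed

text \<open>The exponent is v^2 times the second-order coefficient in \<open>iexp_ln_approx\<close>;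
  this form lets the limit of the characteristic functions be recognized directly.\<close>

lemma char_shifted_normal:
  "char (distr std_normal_distribution borel (\<lambda>z. v * z - v\<^sup>2 / 2)) t
    = exp (\<i> * t * (\<i> * t - 1) / 2 * v\<^sup>2)"
proof -
  interpret S: real_distribution std_normal_distribution by (rule real_dist_normal_dist)
  have "char (distr std_normal_distribution borel (\<lambda>z. v * z - v\<^sup>2 / 2)) t
      = (CLINT z|std_normal_distribution. iexp (t * (v * z - v\<^sup>2 / 2)))"
    unfolding char_def by (subst integral_distr) auto
  also have "\<dots> = (CLINT z|std_normal_distribution. iexp (- t * v\<^sup>2 / 2) * iexp ((t * v) * z))"
  proof (intro Bochner_Integration.integral_cong refl)
    fix z :: real
    have "\<i> * of_real (t * (v * z - v\<^sup>2 / 2)) = \<i> * of_real (- t * v\<^sup>2 / 2) + \<i> * of_real ((t * v) * z)"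
      by (simp add: algebra_simps)
    then show "iexp (t * (v * z - v\<^sup>2 / 2)) = iexp (- t * v\<^sup>2 / 2) * iexp ((t * v) * z)"
      by (simp only: exp_add)
  qed
  also have "\<dots> = iexp (- t * v\<^sup>2 / 2) * char std_normal_distribution (t * v)"
    unfolding char_def by (rule integral_mult_right_zero)
  also have "\<dots> = exp (\<i> * of_real (- t * v\<^sup>2 / 2) + of_real (- ((t * v)\<^sup>2) / 2))"
    unfolding char_std_normal_distribution exp_of_real[symmetric] exp_add ..
  also have "\<i> * of_real (- t * v\<^sup>2 / 2) + of_real (- ((t * v)\<^sup>2) / 2) = \<i> * t * (\<i> * t - 1) / 2 * v\<^sup>2"
    by (simp add: power2_eq_square algebra_simps diff_divide_distrib)
  finally show ?thesis .
qed

text \<open>\<open>exp (v * z - v\<^sup>2 / 2)\<close> is the density ratio of N(v, 1) to N(0, 1),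
  so the integral is that of the smaller of the two densities. They cross at v / 2, and by
  reflection and translation each of the two tails has mass \<Phi>(-v/2).\<close>

lemma integral_min_exp_shifted_normal:
  assumes v: "v > 0"
  shows "(\<integral>x. min 1 (exp x) \<partial>distr std_normal_distribution borel (\<lambda>z. v * z - v\<^sup>2 / 2))
    = 2 * cdf std_normal_distribution (- v / 2)"
proof -
  interpret S: real_distribution std_normal_distribution by (rule real_dist_normal_dist)
  let ?D = std_normal_density
  have cdf: "(\<integral>\<^sup>+z. ennreal (?D z) * indicator {..- v / 2} z \<partial>lborel)
      = ennreal (cdf std_normal_distribution (- v / 2))"
    unfolding cdf_def by (subst S.emeasure_eq_measure[symmetric]) (auto simp: emeasure_density)
  have 1: "(\<integral>\<^sup>+z. ennreal (?D z) * indicator {v / 2..} z \<partial>lborel)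
      = (\<integral>\<^sup>+z. ennreal (?D z) * indicator {..- v / 2} z \<partial>lborel)"
  proof -
    have ind: "indicator {v / 2..} (- z) = (indicator {..- v / 2} z :: ennreal)" for z
      by (auto simp: indicator_def)
    have D: "?D (- z) = ?D z" for z by (simp add: std_normal_density_def)
    have "(\<integral>\<^sup>+z. ennreal (?D z) * indicator {v / 2..} z \<partial>lborel)
        = ennreal \<bar>-1\<bar> * (\<integral>\<^sup>+z. ennreal (?D (0 + -1 * z)) * indicator {v / 2..} (0 + -1 * z) \<partial>lborel)"
      by (rule nn_integral_real_affine) auto
    then show ?thesis by (simp add: ind D)
  qed
  have 2: "(\<integral>\<^sup>+z. ennreal (?D (z - v)) * indicator {..v / 2} z \<partial>lborel)
      = (\<integral>\<^sup>+z. ennreal (?D z) * indicator {..- v / 2} z \<partial>lborel)"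
  proof -
    have ind: "indicator {..v / 2} (v + z) = (indicator {..- v / 2} z :: ennreal)" for z
      by (auto simp: indicator_def)
    have "(\<integral>\<^sup>+z. ennreal (?D (z - v)) * indicator {..v / 2} z \<partial>lborel)
        = ennreal \<bar>1\<bar> * (\<integral>\<^sup>+z. ennreal (?D (v + 1 * z - v)) * indicator {..v / 2} (v + 1 * z) \<partial>lborel)"
      by (rule nn_integral_real_affine) auto
    then show ?thesis by (simp add: ind)
  qed
  have shift: "exp (v * z - v\<^sup>2 / 2) * ?D z = ?D (z - v)" for z
  proof -
    have "v * z - v\<^sup>2 / 2 + - z\<^sup>2 / 2 = - (z - v)\<^sup>2 / 2"
      by (simp add: power2_eq_square field_simps)
    then have "exp (v * z - v\<^sup>2 / 2) * exp (- z\<^sup>2 / 2) = exp (- (z - v)\<^sup>2 / 2)"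
      by (metis exp_add)
    then show ?thesis by (simp add: std_normal_density_def)
  qed
  have "(\<integral>\<^sup>+z. ennreal (min 1 (exp (v * z - v\<^sup>2 / 2))) \<partial>std_normal_distribution)
      = (\<integral>\<^sup>+z. ennreal (?D z) * ennreal (min 1 (exp (v * z - v\<^sup>2 / 2))) \<partial>lborel)"
    by (subst nn_integral_density) auto
  also have "\<dots> = (\<integral>\<^sup>+z. ennreal (?D z) * indicator {v / 2..} z
      + ennreal (?D (z - v)) * indicator {..v / 2} z \<partial>lborel)"
  \<comment> \<open>The crossing point v / 2 lies in both closed half-lines and would be counted
    twice, so it is discarded as a null set.\<close>
  proof (rule nn_integral_cong_AE, use AE_lborel_singleton[of "v / 2"] in eventually_elim)
    fix z assume z: "z \<noteq> v / 2"
    have e: "v * z - v\<^sup>2 / 2 = v * (z - v / 2)" by (simp add: power2_eq_square algebra_simps)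
    show "ennreal (?D z) * ennreal (min 1 (exp (v * z - v\<^sup>2 / 2)))
      = ennreal (?D z) * indicator {v / 2..} z + ennreal (?D (z - v)) * indicator {..v / 2} z"
    proof (cases "z > v / 2")
      case True
      then have "min 1 (exp (v * z - v\<^sup>2 / 2)) = 1" using v unfolding e by simp
      then show ?thesis using True by simp
    next
      case False
      then have "v * (z - v / 2) \<le> 0" using v by (intro mult_nonneg_nonpos) auto
      then have "min 1 (exp (v * z - v\<^sup>2 / 2)) = exp (v * z - v\<^sup>2 / 2)"
        unfolding e by (intro min_absorb2) simp
      moreover have "ennreal (?D z) * ennreal (exp (v * z - v\<^sup>2 / 2)) = ennreal (?D (z - v))"
        unfolding shift[symmetric] by (simp add: ennreal_mult mult.commute)
      ultimately show ?thesis using False z by simp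
    qed
  qed
  also have "\<dots> = ennreal (2 * cdf std_normal_distribution (- v / 2))"
  proof -
    have "(\<integral>\<^sup>+z. ennreal (?D z) * indicator {v / 2..} z
        + ennreal (?D (z - v)) * indicator {..v / 2} z \<partial>lborel)
      = (\<integral>\<^sup>+z. ennreal (?D z) * indicator {v / 2..} z \<partial>lborel)
        + (\<integral>\<^sup>+z. ennreal (?D (z - v)) * indicator {..v / 2} z \<partial>lborel)"
      by (rule nn_integral_add) measurable
    also have "\<dots> = ennreal (2 * cdf std_normal_distribution (- v / 2))"
      unfolding 1 2 cdf mult_2 using S.cdf_nonneg by (intro ennreal_plus[symmetric])
    finally show ?thesis .
  qed
  finally have nn: "(\<integral>\<^sup>+z. ennreal (min 1 (exp (v * z - v\<^sup>2 / 2))) \<partial>std_normal_distribution)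
      = ennreal (2 * cdf std_normal_distribution (- v / 2))" .
  have "(\<integral>x. min 1 (exp x) \<partial>distr std_normal_distribution borel (\<lambda>z. v * z - v\<^sup>2 / 2))
      = (\<integral>z. min 1 (exp (v * z - v\<^sup>2 / 2)) \<partial>std_normal_distribution)"
    by (subst integral_distr) auto
  also have "\<dots> = 2 * cdf std_normal_distribution (- v / 2)"
    using S.cdf_nonneg[of "- v / 2"] by (subst integral_eq_nn_integral) (simp_all only: nn, auto)
  finally show ?thesis .
qed

section \<open>Central limit theorem for products of likelihood ratios\<close>

lemma char_distr_sum_Pi_pmf:
  fixes f :: "'b \<Rightarrow> real"
  assumes fin: "finite A"
  shows "char (distr (Pi_pmf A dflt (\<lambda>_. P)) borel (\<lambda>c. \<Sum>i\<in>A. f (c i))) t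
    = (CLINT x|P. iexp (t * f x)) ^ card A"
proof -
  let ?M = "measure_pmf (Pi_pmf A dflt (\<lambda>_. P))"
  have "prob_space.indep_vars ?M (\<lambda>_. borel) (\<lambda>i c. f (c i)) A"
    by (rule prob_space.indep_vars_compose2[OF measure_pmf.prob_space_axioms indep_vars_Pi_pmf[OF fin]]) auto
  from prob_space.char_distr_sum[OF measure_pmf.prob_space_axioms this]
  have "char (distr ?M borel (\<lambda>c. \<Sum>i\<in>A. f (c i))) t = (\<Prod>i\<in>A. char (distr ?M borel (\<lambda>c. f (c i))) t)" .
  also have "\<dots> = (\<Prod>i\<in>A. CLINT x|P. iexp (t * f x))"
  proof (intro prod.cong refl)
    fix i assume i: "i \<in> A"
    have "char (distr ?M borel (\<lambda>c. f (c i))) t = (CLINT c|?M. iexp (t * f (c i)))"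
      unfolding char_def by (subst integral_distr) auto
    also have "\<dots> = (CLINT x|map_pmf (\<lambda>c. c i) (Pi_pmf A dflt (\<lambda>_. P)). iexp (t * f x))"
      by simp
    also have "map_pmf (\<lambda>c. c i) (Pi_pmf A dflt (\<lambda>_. P)) = P"
      using Pi_pmf_component[OF fin, of i dflt "\<lambda>_. P"] i by simp
    finally show "char (distr ?M borel (\<lambda>c. f (c i))) t = (CLINT x|P. iexp (t * f x))" .
  qed
  finally show ?thesis by simp
qed

text \<open>\<open>iexp_ln_approx\<close> is integrated at y = l x - 1. The linear term vanishes
  because \<open>l\<close> has mean 1, so the variance of \<open>l\<close> alone determines both the
  drift and the spread of the logarithm to leading order.\<close>

lemma expectation_iexp_ln_approx:
  fixes P :: "'a pmf" and l :: "'a \<Rightarrow> real"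
  assumes pos: "\<And>x. l x > 0"
    and int1: "integrable P l" and e1: "measure_pmf.expectation P l = 1"
    and int2: "integrable P (\<lambda>x. (l x - 1)\<^sup>2)" and int3: "integrable P (\<lambda>x. \<bar>l x - 1\<bar> ^ 3)"
  shows "cmod ((CLINT x|P. iexp (t * ln (l x)))
      - (1 + \<i> * t * (\<i> * t - 1) / 2 * measure_pmf.expectation P (\<lambda>x. (l x - 1)\<^sup>2)))
    \<le> (16 + 5 * \<bar>t\<bar> + 3 * t\<^sup>2 + 2 * \<bar>t\<bar> ^ 3) * measure_pmf.expectation P (\<lambda>x. \<bar>l x - 1\<bar> ^ 3)"
    (is "_ \<le> ?C * _")
proof -
  define a where "a = \<i> * t * (\<i> * t - 1) / 2"
  define h where "h x = 1 + \<i> * t * of_real (l x - 1) + a * of_real ((l x - 1)\<^sup>2)" for x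
  have intI: "integrable P (\<lambda>x. iexp (t * ln (l x)))"
    by (rule measure_pmf.integrable_const_bound[where B=1]) auto
  have i1: "integrable P (\<lambda>x. complex_of_real (l x - 1))" using int1 by (intro integrable_of_real) auto
  have i2: "integrable P (\<lambda>x. complex_of_real ((l x - 1)\<^sup>2))" using int2 by (intro integrable_of_real)
  have intH: "integrable P h"
    unfolding h_def by (intro Bochner_Integration.integrable_add integrable_mult_right i1 i2) simp
  have m0: "measure_pmf.expectation P (\<lambda>x. l x - 1) = 0" using int1 e1 by simp
  have "integral\<^sup>L P h = 1 + \<i> * t * (CLINT x|P. complex_of_real (l x - 1))
      + a * (CLINT x|P. complex_of_real ((l x - 1)\<^sup>2))"
  proof -
    have "(CLINT x|P. b * complex_of_real (l x - 1)) = b * (CLINT x|P. complex_of_real (l x - 1))"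
      "(CLINT x|P. b * complex_of_real ((l x - 1)\<^sup>2)) = b * (CLINT x|P. complex_of_real ((l x - 1)\<^sup>2))"
      for b by (rule integral_mult_right_zero)+
    moreover have "integral\<^sup>L P h = (CLINT x|P. 1 + \<i> * t * complex_of_real (l x - 1))
        + (CLINT x|P. a * complex_of_real ((l x - 1)\<^sup>2))"
      unfolding h_def
      by (intro Bochner_Integration.integral_add Bochner_Integration.integrable_add
          integrable_mult_right i1 i2) simp
    moreover have "(CLINT x|P. 1 + \<i> * t * complex_of_real (l x - 1))
        = (CLINT x|P. 1) + (CLINT x|P. \<i> * t * complex_of_real (l x - 1))"
      by (intro Bochner_Integration.integral_add integrable_mult_right i1) simp
    ultimately show ?thesis by (simp only: measure_pmf.prob_space lebesgue_integral_const) simp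
  qed
  also have "\<dots> = 1 + a * measure_pmf.expectation P (\<lambda>x. (l x - 1)\<^sup>2)"
    unfolding integral_complex_of_real m0 of_real_0 mult_zero_right add_0_right ..
  finally have H: "integral\<^sup>L P h = 1 + a * measure_pmf.expectation P (\<lambda>x. (l x - 1)\<^sup>2)" .
  have "(CLINT x|P. iexp (t * ln (l x))) - integral\<^sup>L P h = (CLINT x|P. iexp (t * ln (l x)) - h x)"
    by (rule Bochner_Integration.integral_diff[OF intI intH, symmetric])
  also have "cmod \<dots> \<le> measure_pmf.expectation P (\<lambda>x. cmod (iexp (t * ln (l x)) - h x))"
    by (rule integral_norm_bound)
  also have "\<dots> \<le> measure_pmf.expectation P (\<lambda>x. ?C * \<bar>l x - 1\<bar> ^ 3)"
  proof (rule integral_mono)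
    show "integrable P (\<lambda>x. cmod (iexp (t * ln (l x)) - h x))"
      by (intro integrable_norm Bochner_Integration.integrable_diff intI intH)
    show "integrable P (\<lambda>x. ?C * \<bar>l x - 1\<bar> ^ 3)" by (intro integrable_mult_right int3)
    show "cmod (iexp (t * ln (l x)) - h x) \<le> ?C * \<bar>l x - 1\<bar> ^ 3" for x
    proof -
      have "1 + (l x - 1) = l x" "l x - 1 > -1" using pos[of x] by auto
      then show ?thesis using iexp_ln_approx[of "l x - 1" t]
        unfolding h_def a_def add.assoc of_real_power by metis
    qed
  qed
  also have "\<dots> = ?C * measure_pmf.expectation P (\<lambda>x. \<bar>l x - 1\<bar> ^ 3)"
    by (rule integral_mult_right_zero)
  finally show ?thesis unfolding H a_def .
qed

text \<open>Both \<open>\<phi> n\<close> and \<open>exp (a * s n)\<close> lie in the unit disc, the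
  latter because Re a \<le> 0, so their powers differ by at most \<open>N n\<close> times the
  distance of the bases. Replacing 1 + a s by exp (a s) costs an error of order s^2, and N s^2 = (N
  s)^2 / N vanishes.\<close>

lemma tendsto_power_exp:
  fixes a :: complex and s :: "nat \<Rightarrow> real" and N :: "nat \<Rightarrow> nat" and \<phi> :: "nat \<Rightarrow> complex"
  assumes N: "filterlim N at_top sequentially"
    and a: "Re a \<le> 0" and \<phi>: "\<And>n. cmod (\<phi> n) \<le> 1" and s: "\<And>n. s n \<ge> 0"
    and lim: "(\<lambda>n. real (N n) * s n) \<longlonglongrightarrow> w"
    and err: "(\<lambda>n. real (N n) * cmod (\<phi> n - (1 + a * s n))) \<longlonglongrightarrow> 0"
  shows "(\<lambda>n. \<phi> n ^ N n) \<longlonglongrightarrow> exp (a * w)"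
proof -
  have N': "filterlim (\<lambda>n. real (N n)) at_top sequentially"
    using N filterlim_compose filterlim_real_sequentially by blast
  have ns2: "(\<lambda>n. real (N n) * (s n)\<^sup>2) \<longlonglongrightarrow> 0"
  proof -
    have "(\<lambda>n. (real (N n) * s n)\<^sup>2 / real (N n)) \<longlonglongrightarrow> 0"
      by (rule real_tendsto_divide_at_top[OF tendsto_power[OF lim] N'])
    moreover have "(real (N n) * s n)\<^sup>2 / real (N n) = real (N n) * (s n)\<^sup>2" for n
      by (simp add: power2_eq_square)
    ultimately show ?thesis by simp
  qed
  have s0: "s \<longlonglongrightarrow> 0"
  proof -
    have "(\<lambda>n. (real (N n) * s n) / real (N n)) \<longlonglongrightarrow> 0"
      by (rule real_tendsto_divide_at_top[OF lim N'])
    moreover have "eventually (\<lambda>n. (real (N n) * s n) / real (N n) = s n) sequentially"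
      using filterlim_at_top_dense[THEN iffD1, OF N', rule_format, of 0] by eventually_elim auto
    ultimately show ?thesis by (rule Lim_transform_eventually)
  qed
  have "(\<lambda>n. exp (a * of_real (s n))) \<longlonglongrightarrow> exp (a * of_real 0)"
    by (intro tendsto_intros s0)
  have T: "cmod (exp (a * s n) - (1 + a * s n)) \<le> exp \<bar>Re a * s n\<bar> * (cmod a)\<^sup>2 * (s n)\<^sup>2" for n
    using Taylor_exp[of "a * s n" 1] s[of n]
    by (simp add: norm_mult power_mult_distrib mult_ac power2_eq_square)
  have "(\<lambda>n. \<phi> n ^ N n - exp (a * s n) ^ N n) \<longlonglongrightarrow> 0"
  proof (rule Lim_null_comparison)
    show "\<forall>\<^sub>F n in sequentially. norm (\<phi> n ^ N n - exp (a * s n) ^ N n)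
      \<le> real (N n) * cmod (\<phi> n - (1 + a * s n))
        + exp \<bar>Re a * s n\<bar> * (cmod a)\<^sup>2 * (real (N n) * (s n)\<^sup>2)"
    proof (intro always_eventually allI)
      fix n
      have "Re (a * s n) \<le> 0" using a s[of n] by (simp add: mult_nonpos_nonneg)
      then have "norm (\<phi> n ^ N n - exp (a * s n) ^ N n) \<le> real (N n) * norm (\<phi> n - exp (a * s n))"
        by (intro norm_power_diff \<phi>) simp
      moreover have "norm (\<phi> n - exp (a * s n))
          \<le> cmod (\<phi> n - (1 + a * s n)) + exp \<bar>Re a * s n\<bar> * (cmod a)\<^sup>2 * (s n)\<^sup>2"
        using norm_triangle_ineq4[of "\<phi> n - (1 + a * s n)" "exp (a * s n) - (1 + a * s n)"] T[of n]
        by simp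
      then have "real (N n) * norm (\<phi> n - exp (a * s n)) \<le> real (N n) *
          (cmod (\<phi> n - (1 + a * s n)) + exp \<bar>Re a * s n\<bar> * (cmod a)\<^sup>2 * (s n)\<^sup>2)"
        by (intro mult_left_mono) auto
      ultimately show "norm (\<phi> n ^ N n - exp (a * s n) ^ N n)
      \<le> real (N n) * cmod (\<phi> n - (1 + a * s n))
        + exp \<bar>Re a * s n\<bar> * (cmod a)\<^sup>2 * (real (N n) * (s n)\<^sup>2)"
        by (simp add: algebra_simps)
    qed
    have "(\<lambda>n. real (N n) * cmod (\<phi> n - (1 + a * s n))
        + exp \<bar>Re a * s n\<bar> * (cmod a)\<^sup>2 * (real (N n) * (s n)\<^sup>2))
        \<longlonglongrightarrow> 0 + exp \<bar>Re a * 0\<bar> * (cmod a)\<^sup>2 * 0"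
      by (intro tendsto_intros err ns2 s0)
    then show "(\<lambda>n. real (N n) * cmod (\<phi> n - (1 + a * s n))
        + exp \<bar>Re a * s n\<bar> * (cmod a)\<^sup>2 * (real (N n) * (s n)\<^sup>2)) \<longlonglongrightarrow> 0" by simp
  qed
  moreover have "(\<lambda>n. exp (a * s n) ^ N n) \<longlonglongrightarrow> exp (a * w)"
  proof -
    have "(\<lambda>n. exp (a * of_real (real (N n) * s n))) \<longlonglongrightarrow> exp (a * of_real w)"
      by (intro tendsto_intros lim)
    then show ?thesis by (simp add: mult_ac flip: exp_of_nat_mult)
  qed
  ultimately have "(\<lambda>n. (\<phi> n ^ N n - exp (a * s n) ^ N n) + exp (a * s n) ^ N n) \<longlonglongrightarrow> 0 + exp (a * w)"
    by (rule tendsto_add)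
  then show ?thesis by simp
qed

text \<open>The third-moment hypothesis acts as a Lyapunov condition: it makes the characteristic
  functions of the sums of \<open>ln (l n (c i))\<close> converge, and Levy continuity gives weak
  convergence to the shifted normal law. The function x \<mapsto> min 1 (exp x) is bounded and
  continuous, so its expectation converges too.\<close>

lemma tendsto_expectation_min_1_prod:
  fixes P :: "nat \<Rightarrow> 'a pmf" and l :: "nat \<Rightarrow> 'a \<Rightarrow> real" and N :: "nat \<Rightarrow> nat"
  assumes N: "filterlim N at_top sequentially"
    and l: "\<forall>\<^sub>F n in sequentially. (\<forall>x. l n x > 0) \<and> integrable (P n) (l n) \<and>
      measure_pmf.expectation (P n) (l n) = 1 \<and> integrable (P n) (\<lambda>x. (l n x - 1)\<^sup>2) \<and>
      integrable (P n) (\<lambda>x. \<bar>l n x - 1\<bar> ^ 3)"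
    and var: "(\<lambda>n. real (N n) * measure_pmf.expectation (P n) (\<lambda>x. (l n x - 1)\<^sup>2)) \<longlonglongrightarrow> v\<^sup>2"
    and cube: "(\<lambda>n. real (N n) * measure_pmf.expectation (P n) (\<lambda>x. \<bar>l n x - 1\<bar> ^ 3)) \<longlonglongrightarrow> 0"
    and v: "v > 0"
  shows "(\<lambda>n. measure_pmf.expectation (Pi_pmf {..<N n} dflt (\<lambda>_. P n)) (\<lambda>c. min 1 (\<Prod>i<N n. l n (c i))))
    \<longlonglongrightarrow> 2 * cdf std_normal_distribution (- v / 2)"
proof -
  let ?Q = "\<lambda>n. measure_pmf (Pi_pmf {..<N n} dflt (\<lambda>_. P n))"
  define M where "M n = distr (?Q n) borel (\<lambda>c. \<Sum>i<N n. ln (l n (c i)))" for n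
  define M' where "M' = distr std_normal_distribution borel (\<lambda>z. v * z - v\<^sup>2 / 2)"
  have M: "real_distribution (M n)" for n
    unfolding M_def by (intro prob_space.real_distribution_distr measure_pmf.prob_space_axioms) auto
  have M': "real_distribution M'" unfolding M'_def by (rule real_distribution_shifted_normal)
  have "weak_conv_m M M'"
  proof (rule levy_continuity[OF M M'])
    fix t :: real
    define a where "a = \<i> * t * (\<i> * t - 1) / 2"
    define \<phi> where "\<phi> n = (CLINT x|P n. iexp (t * ln (l n x)))" for n
    define s where "s n = measure_pmf.expectation (P n) (\<lambda>x. (l n x - 1)\<^sup>2)" for n
    let ?C = "16 + 5 * \<bar>t\<bar> + 3 * t\<^sup>2 + 2 * \<bar>t\<bar> ^ 3"
    let ?k = "\<lambda>n. measure_pmf.expectation (P n) (\<lambda>x. \<bar>l n x - 1\<bar> ^ 3)"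
    have "(\<lambda>n. \<phi> n ^ N n) \<longlonglongrightarrow> exp (a * of_real (v\<^sup>2))"
    proof (rule tendsto_power_exp[OF N])
      show "Re a \<le> 0" by (simp add: a_def)
      show "s n \<ge> 0" for n unfolding s_def by simp
      show "(\<lambda>n. real (N n) * s n) \<longlonglongrightarrow> v\<^sup>2" unfolding s_def by (rule var)
      show "cmod (\<phi> n) \<le> 1" for n
      proof -
        have "cmod (\<phi> n) \<le> measure_pmf.expectation (P n) (\<lambda>x. cmod (iexp (t * ln (l n x))))"
          unfolding \<phi>_def by (rule integral_norm_bound)
        then show ?thesis by simp
      qed
      show "(\<lambda>n. real (N n) * cmod (\<phi> n - (1 + a * s n))) \<longlonglongrightarrow> 0"
      proof (rule Lim_null_comparison)
        show "\<forall>\<^sub>F n in sequentially. norm (real (N n) * cmod (\<phi> n - (1 + a * s n))) \<le> ?C * (real (N n) * ?k n)"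
          using l
        proof eventually_elim
          case (elim n)
          then have "cmod (\<phi> n - (1 + a * s n)) \<le> ?C * ?k n"
            unfolding \<phi>_def s_def a_def by (intro expectation_iexp_ln_approx) auto
          from mult_left_mono[OF this, of "real (N n)"] show ?case by (simp add: abs_mult mult_ac)
        qed
        show "(\<lambda>n. ?C * (real (N n) * ?k n)) \<longlonglongrightarrow> 0"
          using tendsto_mult_left[OF cube, of ?C] by simp
      qed
    qed
    moreover have "char (M n) t = \<phi> n ^ N n" for n
      unfolding M_def \<phi>_def
      using char_distr_sum_Pi_pmf[of "{..<N n}" dflt "P n" "\<lambda>x. ln (l n x)" t] by simp
    ultimately show "(\<lambda>n. char (M n) t) \<longlonglongrightarrow> char M' t"
      unfolding M'_def char_shifted_normal a_def by simp
  qed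
  then have "(\<lambda>n. \<integral>x. min 1 (exp x) \<partial>M n) \<longlonglongrightarrow> (\<integral>x. min 1 (exp x) \<partial>M')"
    by (rule weak_conv_imp_integral_bdd_continuous_conv[OF M M', where B=1])
      (auto intro!: continuous_intros)
  moreover have "\<forall>\<^sub>F n in sequentially. (\<integral>x. min 1 (exp x) \<partial>M n)
      = measure_pmf.expectation (Pi_pmf {..<N n} dflt (\<lambda>_. P n)) (\<lambda>c. min 1 (\<Prod>i<N n. l n (c i)))"
    using l
  proof eventually_elim
    case (elim n)
    then have "exp (\<Sum>i<N n. ln (l n (c i))) = (\<Prod>i<N n. l n (c i))" for c
      by (simp add: exp_sum)
    then show ?case unfolding M_def by (subst integral_distr) auto
  qed
  ultimately show ?thesis
    unfolding M'_def integral_min_exp_shifted_normal[OF v] by (rule Lim_transform_eventually)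
qed

section \<open>The random-sign prior and two exponential tail bounds\<close>

text \<open>The default value 1 outside \<open>{..<N}\<close> makes every coordinate a sign, so
  \<open>signs_pmf_values\<close> holds at all indices.\<close>

definition signs_pmf :: "nat \<Rightarrow> (nat \<Rightarrow> real) pmf" where
  "signs_pmf N = Pi_pmf {..<N} 1 (\<lambda>_. pmf_of_set {-1, 1})"

text \<open>For N > 0 this is the average of \<open>1 + d * s i\<close> over i < N, hence the
  normalizer that makes \<open>perturbed_unif\<close> sum to one.\<close>

definition weight :: "nat \<Rightarrow> real \<Rightarrow> (nat \<Rightarrow> real) \<Rightarrow> real" where
  "weight N d s = 1 + d * (\<Sum>i<N. s i) / real N"

definition perturbed_unif :: "nat \<Rightarrow> real \<Rightarrow> (nat \<Rightarrow> real) \<Rightarrow> nat \<Rightarrow> real" where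
  "perturbed_unif N d s = (\<lambda>i\<in>{..<N}. (1 + d * s i) / (real N * weight N d s))"

lemma signs_pmf_values:
  assumes "s \<in> set_pmf (signs_pmf N)"
  shows "s i = -1 \<or> s i = 1"
  using assms by (cases "i < N") (auto simp: signs_pmf_def set_Pi_pmf PiE_dflt_def)

text \<open>Hoeffding's inequality for independent centered variables with values in [-1, 1]. It
  serves to discard sign vectors that are too unbalanced.\<close>

lemma prob_abs_sum_signs_ge:
  assumes N: "N > 0" and \<tau>: "\<tau> > 0"
  shows "measure (signs_pmf N) {s. \<bar>\<Sum>i<N. s i\<bar> \<ge> \<tau> * real N} \<le> 2 * exp (- (\<tau>\<^sup>2 * real N / 2))"
proof -
  have comp: "map_pmf (\<lambda>s. s i) (signs_pmf N) = pmf_of_set {-1, 1}" if "i < N" for i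
    unfolding signs_pmf_def using that by (subst Pi_pmf_component) auto
  have mean: "measure_pmf.expectation (signs_pmf N) (\<lambda>s. s i) = 0" if "i < N" for i
  proof -
    have "measure_pmf.expectation (signs_pmf N) (\<lambda>s. s i)
        = measure_pmf.expectation (map_pmf (\<lambda>s. s i) (signs_pmf N)) (\<lambda>x. x)" by simp
    also have "\<dots> = 0" unfolding comp[OF that] by (subst integral_pmf_of_set) auto
    finally show ?thesis .
  qed
  have indep: "prob_space.indep_vars (signs_pmf N) (\<lambda>_. borel) (\<lambda>i s. s i) {..<N}"
    using prob_space.indep_vars_compose2[OF measure_pmf.prob_space_axioms
        indep_vars_Pi_pmf[of "{..<N}" 1 "\<lambda>_. pmf_of_set {-1, 1}"], of "\<lambda>_ x. x" "\<lambda>_. borel"]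
    by (simp add: signs_pmf_def)
  interpret H: Hoeffding_ineq "signs_pmf N" "{..<N}" "\<lambda>i s. s i" "\<lambda>_. -1" "\<lambda>_. 1" 0
  proof (unfold_locales, goal_cases)
    case 3
    have "s i \<in> {-1..1}" if "s \<in> set_pmf (signs_pmf N)" for s i
      using signs_pmf_values[OF that, of i] by auto
    then show ?case by (simp add: AE_measure_pmf_iff)
  next
    show "0 \<equiv> (\<Sum>i<N. measure_pmf.expectation (signs_pmf N) (\<lambda>s. s i))"
      by (rule eq_reflection) (simp add: mean)
  qed (use indep in auto)
  have "measure (signs_pmf N) {s. \<bar>\<Sum>i<N. s i\<bar> \<ge> \<tau> * real N}
      \<le> 2 * exp (- 2 * (\<tau> * real N)\<^sup>2 / (\<Sum>i<N. (1 - (-1))\<^sup>2))"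
    using H.Hoeffding_ineq_abs_ge[of "\<tau> * real N"] N \<tau> by simp
  also have "- 2 * (\<tau> * real N)\<^sup>2 / (\<Sum>i<N. (1 - (-1))\<^sup>2) = - (\<tau>\<^sup>2 * real N / 2)"
    using N by (simp add: power2_eq_square)
  finally show ?thesis .
qed

text \<open>A Chernoff bound: the indicator of k < n is at most
  \<open>(1 - x) ^ k / (1 - x) ^ n\<close>, whose expectation is known from the generating
  function.\<close>

lemma prob_poisson_less:
  assumes \<rho>: "\<rho> \<ge> real n * (1 + g)" and n: "n > 0" and g: "0 < g" "g \<le> 1"
  shows "measure (poisson_pmf \<rho>) {..<n} \<le> exp (- (real n * g\<^sup>2 / 8))"
proof -
  have \<rho>0: "\<rho> > 0" using \<rho> n g by (smt (verit) mult_pos_pos of_nat_0_less_iff)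
  \<comment> \<open>This choice minimizes 2 x^2 - g x, the coefficient of n left in the exponent,
    with value -g^2 / 8. It also satisfies x \<le> 1/2, the range of the bound ln (1 - x) \<ge> - x
    - 2 x^2.\<close>
  define x where "x = g / 4"
  have x: "0 < x" "x \<le> 1 / 2" using g by (auto simp: x_def)
  have "measure (poisson_pmf \<rho>) {..<n} = measure_pmf.expectation (poisson_pmf \<rho>) (indicator {..<n})"
    by simp
  also have "\<dots> \<le> measure_pmf.expectation (poisson_pmf \<rho>) (\<lambda>k. inverse ((1 - x) ^ n) * (1 - x) ^ k)"
  proof (rule integral_mono)
    show "integrable (poisson_pmf \<rho>) (\<lambda>k. inverse ((1 - x) ^ n) * (1 - x) ^ k)"
      by (intro integrable_mult_right integrable_poisson_power \<rho>0)
    fix k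
    have "(1 - x) ^ n \<le> (1 - x) ^ k" if "k < n"
      using x that by (intro power_decreasing) auto
    then show "indicator {..<n} k \<le> inverse ((1 - x) ^ n) * (1 - x) ^ k"
      using x by (auto simp: indicator_def field_simps)
  qed (auto intro!: measure_pmf.integrable_const_bound[where B=1] simp: indicator_def)
  also have "\<dots> = inverse ((1 - x) ^ n) * exp (- (\<rho> * x))"
    by (simp add: expectation_poisson_power \<rho>0)
  also have "\<dots> = exp (- real n * ln (1 - x) - \<rho> * x)"
  proof -
    have "(1 - x) ^ n = exp (real n * ln (1 - x))"
      using x by (simp add: exp_of_nat_mult)
    then show ?thesis by (simp add: exp_diff exp_minus field_simps)
  qed
  also have "\<dots> \<le> exp (- (real n * g\<^sup>2 / 8))"
  proof -
    have ln: "ln (1 - x) \<ge> - x - 2 * x\<^sup>2" using ln_one_minus_pos_lower_bound[of x] x by simp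
    have "- real n * ln (1 - x) \<le> real n * (x + 2 * x\<^sup>2)"
      using mult_left_mono[OF ln, of "real n"] by (simp add: algebra_simps)
    moreover have "\<rho> * x \<ge> real n * (1 + g) * x" using \<rho> x by (intro mult_right_mono) auto
    moreover have "real n * (x + 2 * x\<^sup>2) - real n * (1 + g) * x = - (real n * g\<^sup>2 / 8)"
      by (simp add: x_def power2_eq_square field_simps)
    ultimately show ?thesis by simp
  qed
  finally show ?thesis .
qed

section \<open>From Poissonized samples to samples of fixed size\<close>

lemma map_take_replicate_pmf:
  assumes "n \<le> m"
  shows "map_pmf (take n) (replicate_pmf m p) = replicate_pmf n p"
proof -
  obtain k where m: "m = n + k" using assms le_Suc_ex by blast
  have "map_pmf (take n) (replicate_pmf m p)
      = replicate_pmf n p \<bind> (\<lambda>xs. replicate_pmf k p \<bind> (\<lambda>ys. return_pmf (take n (xs @ ys))))"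
    unfolding m replicate_pmf_distrib by (simp add: map_bind_pmf)
  also have "\<dots> = replicate_pmf n p \<bind> (\<lambda>xs. replicate_pmf k p \<bind> (\<lambda>ys. return_pmf xs))"
    by (intro bind_pmf_cong refl) (auto simp: set_replicate_pmf)
  finally show ?thesis by (simp add: bind_return_pmf')
qed

text \<open>Given a length of at least \<open>n\<close>, the first \<open>n\<close> observations are
  exactly a sample of size \<open>n\<close>, so a Poissonized sample can simulate the original
  experiment unless it is too short. The first bound serves for rejection under the null hypothesis,
  the second for acceptance under an alternative, where short samples are charged as errors.\<close>

lemma
  shows emeasure_poisson_sample_take_le:
      "emeasure (poisson_sample r p) {xs. n \<le> length xs \<and> take n xs \<in> B}
        \<le> emeasure (replicate_pmf n p) B"
    and emeasure_poisson_sample_short_or_take_le: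
      "emeasure (poisson_sample r p) {xs. length xs < n \<or> take n xs \<in> B}
        \<le> emeasure (poisson_pmf r) {..<n} + emeasure (replicate_pmf n p) B"
proof -
  have long: "emeasure (replicate_pmf m p) {xs. take n xs \<in> B} = emeasure (replicate_pmf n p) B"
    if "n \<le> m" for m
    unfolding map_take_replicate_pmf[OF that, symmetric] by (simp add: vimage_def)
  have len: "AE xs in replicate_pmf m p. length xs = m" for m
    by (auto simp: AE_measure_pmf_iff set_replicate_pmf)
  have 1: "emeasure (replicate_pmf m p) {xs. n \<le> length xs \<and> take n xs \<in> B} \<le> emeasure (replicate_pmf n p) B" for m
  proof (cases "n \<le> m")
    case True
    then show ?thesis unfolding long[OF True, symmetric] by (intro emeasure_mono) auto
  next
    case False
    have "emeasure (replicate_pmf m p) {xs. n \<le> length xs \<and> take n xs \<in> B} \<le> emeasure (replicate_pmf m p) {}"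
      by (rule emeasure_mono_AE) (use len[of m] False in \<open>auto elim: eventually_mono\<close>)
    then show ?thesis by simp
  qed
  have 2: "emeasure (replicate_pmf m p) {xs. length xs < n \<or> take n xs \<in> B}
      \<le> indicator {..<n} m + emeasure (replicate_pmf n p) B" for m
  proof (cases "n \<le> m")
    case True
    have "emeasure (replicate_pmf m p) {xs. length xs < n \<or> take n xs \<in> B}
        \<le> emeasure (replicate_pmf m p) {xs. take n xs \<in> B}"
      by (rule emeasure_mono_AE) (use len[of m] True in \<open>auto elim: eventually_mono\<close>)
    then show ?thesis using True long[OF True] by simp
  next
    case False
    have "emeasure (replicate_pmf m p) {xs. length xs < n \<or> take n xs \<in> B} \<le> 1"
      by (rule measure_pmf.emeasure_le_1)
    then show ?thesis using False by (simp add: add_increasing2)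
  qed
  show "emeasure (poisson_sample r p) {xs. n \<le> length xs \<and> take n xs \<in> B}
        \<le> emeasure (replicate_pmf n p) B"
    unfolding poisson_sample_def emeasure_bind_pmf
    by (rule order_trans[OF nn_integral_mono[OF 1]]) simp
  have "(\<integral>\<^sup>+m. emeasure (replicate_pmf m p) {xs. length xs < n \<or> take n xs \<in> B} \<partial>poisson_pmf r)
      \<le> (\<integral>\<^sup>+m. indicator {..<n} m + emeasure (replicate_pmf n p) B \<partial>poisson_pmf r)"
    by (rule nn_integral_mono[OF 2])
  also have "\<dots> = emeasure (poisson_pmf r) {..<n} + emeasure (replicate_pmf n p) B"
    by (subst nn_integral_add) auto
  finally show "emeasure (poisson_sample r p) {xs. length xs < n \<or> take n xs \<in> B}
        \<le> emeasure (poisson_pmf r) {..<n} + emeasure (replicate_pmf n p) B"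
    unfolding poisson_sample_def emeasure_bind_pmf .
qed

text \<open>Tonelli's theorem, from the symmetry of \<open>pair_pmf\<close>.\<close>

lemma nn_integral_pmf_swap:
  fixes A :: "'a pmf" and B :: "'b pmf"
  shows "(\<integral>\<^sup>+x. \<integral>\<^sup>+y. f x y \<partial>B \<partial>A) = (\<integral>\<^sup>+y. \<integral>\<^sup>+x. f x y \<partial>A \<partial>B)"
proof -
  have "(\<integral>\<^sup>+x. \<integral>\<^sup>+y. f x y \<partial>B \<partial>A) = (\<integral>\<^sup>+z. f (fst z) (snd z) \<partial>pair_pmf A B)"
    by (simp add: nn_integral_pair_pmf')
  also have "\<dots> = (\<integral>\<^sup>+z. f (fst z) (snd z) \<partial>map_pmf (\<lambda>(x, y). (y, x)) (pair_pmf B A))"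
    by (subst pair_commute_pmf) (rule refl)
  also have "\<dots> = (\<integral>\<^sup>+y. \<integral>\<^sup>+x. f x y \<partial>A \<partial>B)"
    by (simp add: nn_integral_pair_pmf' case_prod_beta)
  finally show ?thesis .
qed

section \<open>The perturbed uniform vectors as alternatives\<close>

context
  fixes N :: nat and d :: real and s :: "nat \<Rightarrow> real"
  assumes N: "N > 0" and d: "0 \<le> d" "d < 1" and s: "s \<in> set_pmf (signs_pmf N)"
begin

lemma abs_sum_signs_le: "\<bar>\<Sum>i<N. s i\<bar> \<le> real N"
proof -
  have "\<bar>\<Sum>i<N. s i\<bar> \<le> (\<Sum>i<N. \<bar>s i\<bar>)" by (rule sum_abs)
  also have "\<dots> \<le> (\<Sum>i<N. 1)"   proof (rule sum_mono)
    show "\<bar>s i\<bar> \<le> 1" for i using signs_pmf_values[OF s, of i] by auto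
  qed
  finally show ?thesis by simp
qed

lemma weight_pos: "weight N d s > 0"
proof -
  have "\<bar>d * (\<Sum>i<N. s i) / real N\<bar> = d * (\<bar>\<Sum>i<N. s i\<bar> / real N)"
    using d by (simp add: abs_mult)
  also have "\<dots> \<le> d * 1" using abs_sum_signs_le N d by (intro mult_left_mono) (auto simp: field_simps)
  finally show ?thesis using d unfolding weight_def by linarith
qed

lemma perturbation_nonneg: "1 + d * s i \<ge> 0"
  using signs_pmf_values[OF s, of i] d by auto

lemma perturbed_unif_nonneg: "i < N \<Longrightarrow> perturbed_unif N d s i \<ge> 0"
  using perturbation_nonneg[of i] weight_pos by (simp add: perturbed_unif_def)

lemma sum_perturbed_unif: "(\<Sum>i<N. perturbed_unif N d s i) = 1"
proof -
  have "(\<Sum>i<N. perturbed_unif N d s i) = (\<Sum>i<N. 1 + d * s i) / (real N * weight N d s)"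
    by (simp add: perturbed_unif_def sum_divide_distrib)
  also have "(\<Sum>i<N. 1 + d * s i) = real N * weight N d s"
    using N by (simp add: weight_def sum.distrib distrib_left flip: sum_distrib_left)
  finally show ?thesis using N weight_pos by simp
qed

text \<open>With \<open>T\<close> the mean sign, the deviation at \<open>i\<close> is
  \<open>d * (s i - T)\<close> over \<open>N * weight\<close>. Balance gives |T| \<le> \<tau>, so
  the numerator is at least d (1 - \<tau>) in absolute value and the weight is at most 1 + \<tau>.
  Every coordinate thus deviates by at least \<open>c\<close>, and N equal deviations contribute the
  factor N^(1/p) to the norm.\<close>

lemma perturbed_unif_in_alternatives:
  assumes p: "p > 0" and S: "\<bar>\<Sum>i<N. s i\<bar> \<le> \<tau> * real N" and \<tau>: "0 < \<tau>" "\<tau> < 1"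
    and \<epsilon>: "\<epsilon> > 0" "\<epsilon> \<le> d * ((1 - \<tau>) / (1 + \<tau>)) * real N powr (1 / p - 1)"
  shows "perturbed_unif N d s \<in> alternatives N \<epsilon> p"
proof -
  let ?q = "perturbed_unif N d s" and ?w = "weight N d s"
  define T where "T = (\<Sum>i<N. s i) / real N"
  have T: "\<bar>T\<bar> \<le> \<tau>" using S N by (simp add: T_def abs_divide field_simps)
  have w: "?w = 1 + d * T" by (simp add: weight_def T_def)
  have le1: "?q i \<le> 1" if "i < N" for i
    using sum_perturbed_unif member_le_sum[of i "{..<N}" ?q] that perturbed_unif_nonneg by auto
  have "(\<Sum>i<N. \<bar>?q i\<bar>) = 1"
    using sum_perturbed_unif perturbed_unif_nonneg by (simp add: abs_of_nonneg)
  then have norm1: "lp_norm N 1 ?q = 1" by (simp add: lp_norm_def)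
  define c where "c = d * ((1 - \<tau>) / (1 + \<tau>)) / real N"
  have c0: "c \<ge> 0" unfolding c_def using d \<tau> by auto
  have dev: "\<bar>?q i - unif_vec N i\<bar> \<ge> c" if i: "i < N" for i
  proof -
    have "?q i - unif_vec N i = (1 + d * s i) / (real N * ?w) - ?w / (real N * ?w)"
      using i N weight_pos by (simp add: perturbed_unif_def unif_vec_def)
    also have "\<dots> = d * (s i - T) / (real N * ?w)"
      by (simp add: w algebra_simps flip: diff_divide_distrib)
    finally have "?q i - unif_vec N i = d * (s i - T) / (real N * ?w)" .
    then have "\<bar>?q i - unif_vec N i\<bar> = d * \<bar>s i - T\<bar> / (real N * ?w)"
      using d weight_pos by (simp add: abs_mult)
    also have "\<dots> \<ge> d * (1 - \<tau>) / (real N * (1 + \<tau>))"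
    proof (rule frac_le)
      show "d * (1 - \<tau>) \<le> d * \<bar>s i - T\<bar>"
        using signs_pmf_values[OF s, of i] T d by (intro mult_left_mono) auto
      have "d * T \<le> 1 * \<tau>" using d T \<tau> mult_mono[of d 1 "\<bar>T\<bar>" \<tau>] by (smt (verit) mult_left_mono)
      then show "real N * ?w \<le> real N * (1 + \<tau>)" unfolding w by (intro mult_left_mono) auto
      show "0 < real N * ?w" using N weight_pos by simp
      show "0 \<le> d * \<bar>s i - T\<bar>" using d by simp
    qed
    finally show ?thesis by (simp add: c_def mult_ac)
  qed
  have "\<epsilon> \<le> c * real N powr (1 / p)"
    using \<epsilon>(2) N by (simp add: c_def powr_diff)
  also have "\<dots> = (\<Sum>i<N. c powr p) powr (1 / p)"
    using p c0 by (simp add: powr_mult powr_powr)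
  also have "\<dots> \<le> lp_norm N p (\<lambda>i. ?q i - unif_vec N i)"
    unfolding lp_norm_def using p dev c0
    by (intro powr_mono2 sum_mono sum_nonneg) auto
  finally show ?thesis
    unfolding alternatives_def using le1 perturbed_unif_nonneg norm1
    by (auto simp: perturbed_unif_def)
qed

text \<open>This is the relation required by \<open>nn_integral_poisson_sample_tilt\<close>, with
  \<open>1 + d * s x\<close> as the tilting function.\<close>

lemma pmf_categorical_perturbed_unif:
  "weight N d s * pmf (categorical_pmf N (perturbed_unif N d s)) x
    = (1 + d * s x) * pmf (categorical_pmf N (unif_vec N)) x"
proof -
  have "pmf (categorical_pmf N (unif_vec N)) x = (if x < N then unif_vec N x else 0)"
    using N by (intro pmf_categorical) (auto simp: unif_vec_def)
  moreover have "pmf (categorical_pmf N (perturbed_unif N d s)) x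
      = (if x < N then perturbed_unif N d s x else 0)"
    by (intro pmf_categorical perturbed_unif_nonneg sum_perturbed_unif)
  ultimately show ?thesis
    using weight_pos N by (simp add: perturbed_unif_def unif_vec_def)
qed

end

section \<open>The mixture likelihood ratio and the lower bound on the risk\<close>

lemma prod_list_map_count_list:
  fixes f :: "'a \<Rightarrow> 'b :: comm_monoid_mult"
  assumes "finite A" "set xs \<subseteq> A"
  shows "(\<Prod>x\<leftarrow>xs. f x) = (\<Prod>i\<in>A. f i ^ count_list xs i)"
  using assms(2)
proof (induction xs)
  case (Cons a xs)
  then have a: "a \<in> A" and IH: "(\<Prod>x\<leftarrow>xs. f x) = (\<Prod>i\<in>A. f i ^ count_list xs i)" by auto
  have "(\<Prod>i\<in>A. f i ^ count_list (a # xs) i)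
      = f a ^ Suc (count_list xs a) * (\<Prod>i\<in>A - {a}. f i ^ count_list xs i)"
    by (subst prod.remove[OF assms(1) a]) (auto intro!: prod.cong arg_cong2[where f="(*)"] split: if_splits)
  also have "\<dots> = f a * (\<Prod>i\<in>A. f i ^ count_list xs i)"
    by (subst prod.remove[OF assms(1) a, of "\<lambda>i. f i ^ count_list xs i"]) (simp add: mult.assoc)
  finally show ?case using IH by simp
qed simp

text \<open>\<open>r - r * weight N d s\<close> is a sum over the coordinates, so the integrand is a
  product of functions of the single signs and its average over independent signs factorizes into
  the terms \<open>mix_lr\<close>. The absolute values keep the factors nonnegative for every
  \<open>s\<close>, not only on the support of the prior.\<close>

lemma nn_integral_signs_likelihood:
  assumes N: "N > 0" and d: "0 \<le> d" "d < 1" and xs: "set xs \<subseteq> {..<N}"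
  shows "(\<integral>\<^sup>+s. ennreal (exp (r - r * weight N d s) * (\<Prod>x\<leftarrow>xs. \<bar>1 + d * s x\<bar>)) \<partial>signs_pmf N)
    = ennreal (\<Prod>i<N. mix_lr (r / real N) d (count_list xs i))"
proof -
  define f where "f i e = exp (- (r / real N * d * e)) * \<bar>1 + d * e\<bar> ^ count_list xs i" for i e
  have f0: "f i e \<ge> 0" for i e by (simp add: f_def)
  have "exp (r - r * weight N d s) * (\<Prod>x\<leftarrow>xs. \<bar>1 + d * s x\<bar>) = (\<Prod>i<N. f i (s i))" for s
  proof -
    have "r - r * weight N d s = (\<Sum>i<N. - (r / real N * d * s i))"
      using N by (simp add: weight_def sum_negf sum_distrib_left sum_divide_distrib algebra_simps)
    then have "exp (r - r * weight N d s) = (\<Prod>i<N. exp (- (r / real N * d * s i)))"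
      by (simp add: exp_sum)
    then show ?thesis
      unfolding prod_list_map_count_list[OF finite_lessThan xs] f_def prod.distrib by simp
  qed
  then have "(\<integral>\<^sup>+s. ennreal (exp (r - r * weight N d s) * (\<Prod>x\<leftarrow>xs. \<bar>1 + d * s x\<bar>)) \<partial>signs_pmf N)
    = (\<integral>\<^sup>+s. (\<Prod>i<N. ennreal (f i (s i))) \<partial>signs_pmf N)"
    by (simp add: prod_ennreal f0)
  also have "\<dots> = (\<Prod>i<N. \<integral>\<^sup>+e. ennreal (f i e) \<partial>pmf_of_set {-1, 1})"
    unfolding signs_pmf_def by (rule nn_integral_prod_Pi_pmf) simp
  also have "\<dots> = (\<Prod>i<N. ennreal (mix_lr (r / real N) d (count_list xs i)))"
  proof (intro prod.cong refl)
    fix i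
    have "(\<integral>\<^sup>+e. ennreal (f i e) \<partial>pmf_of_set {-1, 1}) = (ennreal (f i (-1)) + ennreal (f i 1)) / 2"
      by (subst nn_integral_pmf_of_set) auto
    also have "\<dots> = ennreal ((f i (-1) + f i 1) / 2)"
      by (simp add: f0 ennreal_plus[symmetric] divide_ennreal[symmetric] del: ennreal_plus)
    also have "(f i (-1) + f i 1) / 2 = mix_lr (r / real N) d (count_list xs i)"
      using d by (simp add: f_def mix_lr_def mult_ac)
    finally show "(\<integral>\<^sup>+e. ennreal (f i e) \<partial>pmf_of_set {-1, 1}) = ennreal (mix_lr (r / real N) d (count_list xs i))" .
  qed
  finally show ?thesis using mix_lr_pos[OF d] by (simp add: prod_ennreal less_imp_le)
qed

lemma emeasure_multinomial_pmf:
  "emeasure (multinomial_pmf n N q) C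
    = emeasure (replicate_pmf n (categorical_pmf N q)) {xs. (\<lambda>i\<in>{..<N}. count_list xs i) \<in> C}"
  unfolding multinomial_pmf_def by (simp add: vimage_def)


text \<open>Neyman--Pearson for the mixture over the signs: on Poissonized samples, run the test on the
  first \<open>n\<close> observations and accept if there are fewer.\<close>

lemma expectation_min_le_test_risk:
  assumes N: "N > 0" and n: "n > 0" and r: "r > 0" and d: "0 \<le> d" "d < 1" and p: "p > 0"
    and \<tau>: "0 < \<tau>" "\<tau> < 1"
    and \<epsilon>: "\<epsilon> > 0" "\<epsilon> \<le> d * ((1 - \<tau>) / (1 + \<tau>)) * real N powr (1 / p - 1)"
    and g: "0 < g" "g \<le> 1" "real n * (1 + g) \<le> r * (1 - d * \<tau>)"
    and \<psi>: "range \<psi> \<subseteq> {0, 1}"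
  shows "ennreal (measure_pmf.expectation (Pi_pmf {..<N} 0 (\<lambda>_. poisson_pmf (r / real N)))
      (\<lambda>c. min 1 (\<Prod>i<N. mix_lr (r / real N) d (c i))))
    \<le> test_risk n N \<epsilon> p \<psi> + ennreal (2 * exp (- (\<tau>\<^sup>2 * real N / 2)) + exp (- (real n * g\<^sup>2 / 8)))"
proof -
  define p0 where "p0 = categorical_pmf N (unif_vec N)"
  define P0 where "P0 = poisson_sample r p0"
  define L where "L xs = (\<Prod>i<N. mix_lr (r / real N) d (count_list xs i))" for xs
  define B where "B j = {xs. \<psi> (\<lambda>i\<in>{..<N}. count_list xs i) = j}" for j
  define A where "A = {xs. n \<le> length xs \<and> take n xs \<in> B 1}"
  define q where "q s = categorical_pmf N (perturbed_unif N d s)" for s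
  define \<beta> where "\<beta> = exp (- (real n * g\<^sup>2 / 8))"
  define T where "T = (SUP q \<in> alternatives N \<epsilon> p. emeasure (multinomial_pmf n N q) {c. \<psi> c = 0})"
  have pmf_p0: "pmf p0 x = (if x < N then 1 / real N else 0)" for x
    unfolding p0_def using N by (subst pmf_categorical) (auto simp: unif_vec_def)
  have set_p0: "set_pmf p0 = {..<N}"
    using N by (auto simp: set_pmf_iff pmf_p0 split: if_splits)
  have L0: "L xs \<ge> 0" for xs
    unfolding L_def using mix_lr_pos[OF d] by (intro prod_nonneg) (simp add: less_imp_le)
  have eq: "map_pmf count_list P0 = Pi_pmf {..<N} 0 (\<lambda>_. poisson_pmf (r / real N))"
    unfolding P0_def by (subst map_count_list_poisson_sample)
      (auto simp: set_p0 r pmf_p0 intro!: Pi_pmf_cong)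
  have "ennreal (measure_pmf.expectation (Pi_pmf {..<N} 0 (\<lambda>_. poisson_pmf (r / real N)))
      (\<lambda>c. min 1 (\<Prod>i<N. mix_lr (r / real N) d (c i)))) = ennreal (measure_pmf.expectation P0 (\<lambda>xs. min 1 (L xs)))"
    unfolding L_def eq[symmetric] integral_map_pmf ..
  also have "\<dots> = (\<integral>\<^sup>+xs. ennreal (min 1 (L xs)) \<partial>P0)"
    by (rule nn_integral_eq_integral[symmetric])
      (use L0 in \<open>auto intro!: measure_pmf.integrable_const_bound[where B=1]\<close>)
  \<comment> \<open>The Neyman-Pearson inequality holds pointwise for any rejection region: min 1 L
    is at most 1 on \<open>A\<close> and at most L off \<open>A\<close>.\<close>
  also have "\<dots> \<le> (\<integral>\<^sup>+xs. indicator A xs + ennreal (L xs) * indicator (- A) xs \<partial>P0)"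
  proof (rule nn_integral_mono)
    have "ennreal (min 1 (L xs)) \<le> ennreal 1" "ennreal (min 1 (L xs)) \<le> ennreal (L xs)" for xs
      by (intro ennreal_leI; simp)+
    then show "ennreal (min 1 (L xs)) \<le> indicator A xs + ennreal (L xs) * indicator (- A) xs" for xs
      by (simp add: indicator_def)
  qed
  also have "\<dots> = emeasure P0 A + (\<integral>\<^sup>+xs. ennreal (L xs) * indicator (- A) xs \<partial>P0)"
    by (subst nn_integral_add) auto
  also have "(\<integral>\<^sup>+xs. ennreal (L xs) * indicator (- A) xs \<partial>P0)
      = (\<integral>\<^sup>+xs. \<integral>\<^sup>+s. ennreal (exp (r - r * weight N d s) * (\<Prod>x\<leftarrow>xs. \<bar>1 + d * s x\<bar>)) * indicator (- A) xs \<partial>signs_pmf N \<partial>P0)"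
  proof (rule nn_integral_cong_AE, rule AE_pmfI)
    fix xs assume "xs \<in> set_pmf P0"
    then have "set xs \<subseteq> {..<N}"
      by (auto simp: P0_def poisson_sample_def set_replicate_pmf set_p0)
    from nn_integral_signs_likelihood[OF N d this, of r]
    show "ennreal (L xs) * indicator (- A) xs
      = (\<integral>\<^sup>+s. ennreal (exp (r - r * weight N d s) * (\<Prod>x\<leftarrow>xs. \<bar>1 + d * s x\<bar>)) * indicator (- A) xs \<partial>signs_pmf N)"
      unfolding L_def by (simp add: nn_integral_multc)
  qed
  \<comment> \<open>After the swap, the acceptance probability under the mixture is an average over
    \<open>s\<close> of acceptance probabilities under single alternatives, which can be bounded one
    sign vector at a time.\<close>
  also have "\<dots> = (\<integral>\<^sup>+s. \<integral>\<^sup>+xs. ennreal (exp (r - r * weight N d s) * (\<Prod>x\<leftarrow>xs. \<bar>1 + d * s x\<bar>)) * indicator (- A) xs \<partial>P0 \<partial>signs_pmf N)"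
    by (rule nn_integral_pmf_swap)
  also have "\<dots> \<le> (\<integral>\<^sup>+s. indicator {s. \<bar>\<Sum>i<N. s i\<bar> \<ge> \<tau> * real N} s + (ennreal \<beta> + T) \<partial>signs_pmf N)"
  proof (rule nn_integral_mono_AE, rule AE_pmfI)
    fix s assume s: "s \<in> set_pmf (signs_pmf N)"
    have w: "weight N d s > 0" by (rule weight_pos[OF N d s])
    have "(\<integral>\<^sup>+xs. ennreal (exp (r - r * weight N d s) * (\<Prod>x\<leftarrow>xs. \<bar>1 + d * s x\<bar>)) * indicator (- A) xs \<partial>P0)
        = (\<integral>\<^sup>+xs. indicator (- A) xs \<partial>poisson_sample (r * weight N d s) (q s))"
      unfolding P0_def p0_def q_def
      using pmf_categorical_perturbed_unif[OF N d s] perturbation_nonneg[OF N d s]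
      by (intro nn_integral_poisson_sample_tilt[symmetric] r w) auto
    also have "\<dots> = emeasure (poisson_sample (r * weight N d s) (q s)) (- A)" by simp
    also have "\<dots> \<le> indicator {s. \<bar>\<Sum>i<N. s i\<bar> \<ge> \<tau> * real N} s + (ennreal \<beta> + T)"
    proof (cases "\<bar>\<Sum>i<N. s i\<bar> \<ge> \<tau> * real N")
      \<comment> \<open>An unbalanced sign vector need not give an admissible alternative; the
        trivial bound 1 is used and charged to the indicator.\<close>
      case True
      then show ?thesis
        using measure_pmf.emeasure_le_1[of "poisson_sample (r * weight N d s) (q s)" "- A"]
        by (simp add: add_increasing2)
    next
      case False
      then have S: "\<bar>\<Sum>i<N. s i\<bar> \<le> \<tau> * real N" by simp
      have "\<psi> c \<noteq> 1 \<longleftrightarrow> \<psi> c = 0" for c using range_subsetD[OF \<psi>, of c] by auto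
      then have "xs \<in> - A \<longleftrightarrow> length xs < n \<or> take n xs \<in> B 0" for xs
        unfolding A_def B_def by (simp only: Compl_iff mem_Collect_eq de_Morgan_conj not_le)
      then have "- A = {xs. length xs < n \<or> take n xs \<in> B 0}" by blast
      then have "emeasure (poisson_sample (r * weight N d s) (q s)) (- A)
          \<le> emeasure (poisson_pmf (r * weight N d s)) {..<n} + emeasure (replicate_pmf n (q s)) (B 0)"
        by (simp only: emeasure_poisson_sample_short_or_take_le)
      also have "\<dots> \<le> ennreal \<beta> + T"
      proof (rule add_mono)
        \<comment> \<open>Balance keeps the tilted Poisson mean \<open>r * weight N d s\<close> at
          or above n (1 + g), so that samples shorter than \<open>n\<close> remain unlikely.\<close>
        have "d * (\<Sum>i<N. s i) \<ge> d * (- (\<tau> * real N))" using S d by (intro mult_left_mono) auto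
        then have "weight N d s \<ge> 1 - d * \<tau>" using N by (simp add: weight_def field_simps)
        then have "r * (1 - d * \<tau>) \<le> r * weight N d s" using r by simp
        with g have "measure (poisson_pmf (r * weight N d s)) {..<n} \<le> \<beta>"
          unfolding \<beta>_def by (intro prob_poisson_less n) auto
        then show "emeasure (poisson_pmf (r * weight N d s)) {..<n} \<le> ennreal \<beta>"
          by (simp add: measure_pmf.emeasure_eq_measure ennreal_leI)
        have "perturbed_unif N d s \<in> alternatives N \<epsilon> p"
          by (rule perturbed_unif_in_alternatives[OF N d s p S \<tau> \<epsilon>])
        then show "emeasure (replicate_pmf n (q s)) (B 0) \<le> T"
          unfolding T_def by (rule SUP_upper2) (simp add: emeasure_multinomial_pmf B_def q_def)
      qed
      finally show ?thesis using False by simp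
    qed
    finally show "(\<integral>\<^sup>+xs. ennreal (exp (r - r * weight N d s) * (\<Prod>x\<leftarrow>xs. \<bar>1 + d * s x\<bar>)) * indicator (- A) xs \<partial>P0)
        \<le> indicator {s. \<bar>\<Sum>i<N. s i\<bar> \<ge> \<tau> * real N} s + (ennreal \<beta> + T)" .
  qed
  also have "\<dots> = emeasure (signs_pmf N) {s. \<bar>\<Sum>i<N. s i\<bar> \<ge> \<tau> * real N} + (ennreal \<beta> + T)"
    by (subst nn_integral_add) auto
  also have "\<dots> \<le> ennreal (2 * exp (- (\<tau>\<^sup>2 * real N / 2))) + (ennreal \<beta> + T)"
    using prob_abs_sum_signs_ge[OF N \<tau>(1)]
    by (intro add_right_mono) (simp add: measure_pmf.emeasure_eq_measure ennreal_leI)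
  finally have "ennreal (measure_pmf.expectation (Pi_pmf {..<N} 0 (\<lambda>_. poisson_pmf (r / real N)))
      (\<lambda>c. min 1 (\<Prod>i<N. mix_lr (r / real N) d (c i))))
    \<le> emeasure P0 A + (ennreal (2 * exp (- (\<tau>\<^sup>2 * real N / 2))) + (ennreal \<beta> + T))"
    by (simp add: add_left_mono)
  also have "emeasure P0 A \<le> emeasure (multinomial_pmf n N (unif_vec N)) {c. \<psi> c = 1}"
    unfolding A_def P0_def p0_def emeasure_multinomial_pmf
    by (rule order_trans[OF emeasure_poisson_sample_take_le]) (simp add: B_def)
  finally show ?thesis
    unfolding test_risk_def T_def \<beta>_def by (simp add: add_ac add_right_mono)
qed

lemma ennreal_diff_le_minimax_risk:
  assumes "\<And>\<psi>. range \<psi> \<subseteq> {0, 1} \<Longrightarrow> ennreal a \<le> test_risk n N \<epsilon> p \<psi> + ennreal \<delta>"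
    and "\<delta> \<ge> 0"
  shows "ennreal (a - \<delta>) \<le> minimax_risk n N \<epsilon> p"
  unfolding minimax_risk_def
proof (rule INF_greatest, clarsimp)
  fix \<psi> :: "(nat \<Rightarrow> nat) \<Rightarrow> nat"
  assume "range \<psi> \<subseteq> {0, Suc 0}"
  then have "ennreal a \<le> test_risk n N \<epsilon> p \<psi> + ennreal \<delta>" using assms(1) by simp
  then have "ennreal a - ennreal \<delta> \<le> test_risk n N \<epsilon> p \<psi>"
    by (simp add: ennreal_minus_le_iff add.commute)
  then show "ennreal (a - \<delta>) \<le> test_risk n N \<epsilon> p \<psi>"
    using assms(2) by (simp add: ennreal_minus)
qed

section \<open>Choice of the parameters and passage to the limit\<close>

lemma tendsto_mult_cosh_minus_1:
  fixes b m :: "nat \<Rightarrow> real"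
  assumes b: "b \<longlonglongrightarrow> 0" "\<forall>\<^sub>F n in sequentially. b n > 0"
    and m: "(\<lambda>n. m n * (b n)\<^sup>2) \<longlonglongrightarrow> w"
  shows "(\<lambda>n. m n * (cosh (b n) - 1)) \<longlonglongrightarrow> w / 2"
proof -
  have "((\<lambda>x::real. (cosh x - 1) / x\<^sup>2) \<longlongrightarrow> 1 / 2) (at_right 0)"
    unfolding cosh_field_def by real_asymp
  moreover have "filterlim b (at_right 0) sequentially"
    using b by (auto simp: filterlim_at elim: eventually_mono)
  ultimately have "(\<lambda>n. (cosh (b n) - 1) / (b n)\<^sup>2) \<longlonglongrightarrow> 1 / 2"
    by (rule filterlim_compose)
  from tendsto_mult[OF m this]
  have "(\<lambda>n. m n * (b n)\<^sup>2 * ((cosh (b n) - 1) / (b n)\<^sup>2)) \<longlonglongrightarrow> w / 2" by simp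
  moreover have "\<forall>\<^sub>F n in sequentially. m n * (b n)\<^sup>2 * ((cosh (b n) - 1) / (b n)\<^sup>2) = m n * (cosh (b n) - 1)"
    using b(2) by eventually_elim simp
  ultimately show ?thesis by (rule Lim_transform_eventually)
qed

theorem theorem2p1:
  fixes p u_star :: real and N :: "nat \<Rightarrow> nat" and \<epsilon> u :: "nat \<Rightarrow> real"
  assumes p_pos: "p > 0"
    and N_pos: "\<And>n. n \<ge> 1 \<Longrightarrow> N n > 0"
    and eps_pos: "\<And>n. n \<ge> 1 \<Longrightarrow> \<epsilon> n > 0"
    and u_def: "\<And>n. u n = (\<epsilon> n)\<^sup>2 * real n * real (N n) powr (3 / 2 - 2 / p) / sqrt 2"
    and N_tendsto: "filterlim N at_top sequentially"
    and N_little_o: "(\<lambda>n. real (N n)) \<in> o(\<lambda>n. (real n)\<^sup>2)"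
    and n_big_O: "(\<lambda>n. real n) \<in> O(\<lambda>n. real (N n))"
    and u_star_pos: "u_star > 0"
    and u_tendsto: "u \<longlonglongrightarrow> u_star"
  shows "liminf (\<lambda>n. minimax_risk n (N n) (\<epsilon> n) p)
           \<ge> ennreal (2 * cdf std_normal_distribution (- u_star / 2))"
proof -
  \<comment> \<open>The exponents -1/4 in \<open>\<tau>\<close> and \<open>\<eta>\<close> make both
    tend to 0 while \<tau>^2 N = sqrt N and \<eta>^2 n = sqrt n still diverge, so that both tail
    bounds vanish.\<close>
  define \<tau> where "\<tau> n = real (N n) powr (- 1 / 4)" for n
  define c where "c n = (1 - \<tau> n) / (1 + \<tau> n)" for n
  define \<eta> where "\<eta> n = real n powr (- 1 / 4)" for n
  define r where "r n = real n * (1 + \<eta> n)" for n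
  \<comment> \<open>Dividing by \<open>c n\<close> compensates for the loss (1 - \<tau>) / (1 +
    \<tau>) in \<open>perturbed_unif_in_alternatives\<close>, so that the guaranteed departure is
    exactly \<open>\<epsilon> n\<close>. The loss disappears in the limit since \<open>c\<close>
    tends to 1.\<close>
  define d where "d n = \<epsilon> n * real (N n) powr (1 - 1 / p) / c n" for n
  define lam where "lam n = r n / real (N n)" for n
  define b where "b n = lam n * (d n)\<^sup>2" for n
  \<comment> \<open>\<open>K\<close> isolates the convergent part of d^2, namely d^2 = K sqrt N /
    n.\<close>
  define K where "K n = sqrt 2 * u n / (c n)\<^sup>2" for n
  have N': "filterlim (\<lambda>n. real (N n)) at_top sequentially"
    using N_tendsto filterlim_compose filterlim_real_sequentially by blast
  have n1: "\<forall>\<^sub>F n in sequentially. n \<ge> (1::nat)" by (rule eventually_ge_at_top)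
  have N1: "\<forall>\<^sub>F n in sequentially. real (N n) > 1"
    using N' unfolding filterlim_at_top_dense by blast
  have \<tau>0: "\<tau> \<longlonglongrightarrow> 0"
    unfolding \<tau>_def by (rule tendsto_neg_powr[OF _ N']) simp
  have \<eta>0: "\<eta> \<longlonglongrightarrow> 0"
    unfolding \<eta>_def by (rule tendsto_neg_powr[OF _ filterlim_real_sequentially]) simp
  have \<eta>_bounds: "\<eta> n \<le> 1" "\<eta> n > 0" if "n \<ge> 1" for n
    using that powr_mono2'[of "-1/4" 1 "real n"] by (auto simp: \<eta>_def)
  have \<tau>_bounds: "\<tau> n < 1" "\<tau> n > 0" if "real (N n) > 1" for n
    using that powr_less_mono2_neg[of "-1/4" 1 "real (N n)"] by (auto simp: \<tau>_def)
  have c_pos: "c n > 0" if "real (N n) > 1" for n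
    using \<tau>_bounds[OF that] by (simp add: c_def)
  have c1: "c \<longlonglongrightarrow> 1"
  proof -
    have "(\<lambda>n. (1 - \<tau> n) / (1 + \<tau> n)) \<longlonglongrightarrow> (1 - 0) / (1 + 0)"
      by (intro tendsto_intros \<tau>0) simp
    then show ?thesis by (simp add: c_def[abs_def])
  qed
  have K: "K \<longlonglongrightarrow> sqrt 2 * u_star"
  proof -
    have "(\<lambda>n. sqrt 2 * u n / (c n)\<^sup>2) \<longlonglongrightarrow> sqrt 2 * u_star / 1\<^sup>2"
      by (intro tendsto_intros u_tendsto c1) simp
    then show ?thesis by (simp add: K_def[abs_def])
  qed
  have d2: "(d n)\<^sup>2 = K n * (sqrt (real (N n)) / real n)" if "n \<ge> 1" for n
  proof -
    have N0: "real (N n) > 0" and n0: "real n > 0" using N_pos[OF that] that by auto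
    have "(real (N n) powr (1 - 1 / p))\<^sup>2 = real (N n) powr (3 / 2 - 2 / p) * sqrt (real (N n))"
      using N0 by (simp add: power2_eq_square powr_half_sqrt[symmetric] flip: powr_add)
    then have "(d n)\<^sup>2 = (\<epsilon> n)\<^sup>2 * (real (N n) powr (3 / 2 - 2 / p) * sqrt (real (N n))) / (c n)\<^sup>2"
      by (simp add: d_def power_divide power_mult_distrib)
    also have "\<dots> = K n * (sqrt (real (N n)) / real n)"
      using n0 by (simp add: K_def u_def)
    finally show ?thesis .
  qed
  \<comment> \<open>Here N = o(n^2) enters: it forces the relative perturbation \<open>d\<close> to
    0.\<close>
  have sqrtN: "(\<lambda>n. sqrt (real (N n)) / real n) \<longlonglongrightarrow> 0"
  proof -
    have "(\<lambda>n. sqrt (real (N n) / (real n)\<^sup>2)) \<longlonglongrightarrow> sqrt 0"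
      by (intro tendsto_intros smalloD_tendsto[OF N_little_o])
    then show ?thesis by (simp add: real_sqrt_divide)
  qed
  have d2_lim: "(\<lambda>n. (d n)\<^sup>2) \<longlonglongrightarrow> 0"
  proof -
    have "(\<lambda>n. K n * (sqrt (real (N n)) / real n)) \<longlonglongrightarrow> sqrt 2 * u_star * 0"
      by (intro tendsto_mult K sqrtN)
    moreover have "\<forall>\<^sub>F n in sequentially. K n * (sqrt (real (N n)) / real n) = (d n)\<^sup>2"
      using n1 by eventually_elim (simp add: d2)
    ultimately show ?thesis unfolding mult_zero_right by (rule Lim_transform_eventually)
  qed
  have d_pos: "\<forall>\<^sub>F n in sequentially. d n > 0"
    using n1 N1 by eventually_elim (use eps_pos c_pos in \<open>simp add: d_def\<close>)
  have d_less: "\<forall>\<^sub>F n in sequentially. d n < 1"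
    using order_tendstoD(2)[OF d2_lim, of 1] by (auto elim!: eventually_mono simp: power2_less_imp_less[of _ 1])
  have lam_pos: "\<forall>\<^sub>F n in sequentially. lam n > 0"
    using n1 N1 by eventually_elim (use \<eta>_bounds in \<open>auto simp: lam_def r_def intro!: divide_pos_pos mult_pos_pos add_pos_pos\<close>)
  \<comment> \<open>Here n = O(N) enters: the Poisson means per category stay bounded, as the
    uniform third-moment estimate requires.\<close>
  obtain R where R: "R > 0" "\<forall>\<^sub>F n in sequentially. lam n \<le> R"
  proof -
    obtain B where B: "B > 0" "\<forall>\<^sub>F n in sequentially. norm (real n) \<le> B * norm (real (N n))"
      using n_big_O by (rule landau_o.bigE)
    have "\<forall>\<^sub>F n in sequentially. lam n \<le> 2 * B"
      using B(2) n1 N1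
    proof eventually_elim
      case (elim n)
      have "r n \<le> (B * real (N n)) * 2"
        unfolding r_def using elim \<eta>_bounds[of n] by (intro mult_mono) auto
      then show ?case using elim by (simp add: lam_def field_simps)
    qed
    with B(1) show thesis by (intro that[of "2 * B"]) auto
  qed
  have b_eq: "b n = (1 + \<eta> n) * K n / sqrt (real (N n))" if "n \<ge> 1" for n
  proof -
    have N0: "real (N n) > 0" using N_pos[OF that] by simp
    then have "real (N n) = sqrt (real (N n)) * sqrt (real (N n))" by simp
    then show ?thesis using that N0
      by (simp add: b_def lam_def r_def d2[OF that] divide_simps)
  qed
  have b0: "b \<longlonglongrightarrow> 0"
  proof -
    have "(\<lambda>n. (1 + \<eta> n) * K n / sqrt (real (N n))) \<longlonglongrightarrow> 0"
      by (rule real_tendsto_divide_at_top[of _ "(1 + 0) * (sqrt 2 * u_star)"])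
        (intro tendsto_intros \<eta>0 K filterlim_compose[OF sqrt_at_top N'])+
    moreover have "\<forall>\<^sub>F n in sequentially. (1 + \<eta> n) * K n / sqrt (real (N n)) = b n"
      using n1 by eventually_elim (simp add: b_eq)
    ultimately show ?thesis by (rule Lim_transform_eventually)
  qed
  have b_pos: "\<forall>\<^sub>F n in sequentially. b n > 0"
    using lam_pos d_pos by eventually_elim (simp add: b_def)
  \<comment> \<open>Since b = (1 + \<eta>) K / sqrt N, the limit is the square of sqrt 2 times
    \<open>u_star\<close>. The factor 2 cancels against cosh b - 1 \<sim> b^2 / 2, leaving the
    variance \<open>u_star\<^sup>2\<close>.\<close>
  have Nb2: "(\<lambda>n. real (N n) * (b n)\<^sup>2) \<longlonglongrightarrow> 2 * u_star\<^sup>2"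
  proof -
    have "(\<lambda>n. ((1 + \<eta> n) * K n)\<^sup>2) \<longlonglongrightarrow> ((1 + 0) * (sqrt 2 * u_star))\<^sup>2"
      by (intro tendsto_intros \<eta>0 K)
    moreover have "\<forall>\<^sub>F n in sequentially. ((1 + \<eta> n) * K n)\<^sup>2 = real (N n) * (b n)\<^sup>2"
      using n1 N1 by eventually_elim (simp add: b_eq power_divide)
    ultimately show ?thesis
      by (auto intro: Lim_transform_eventually simp: power_mult_distrib)
  qed
  obtain C where C: "C > 0"
    "\<And>r d. 0 < r \<Longrightarrow> r \<le> R \<Longrightarrow> 0 \<le> d \<Longrightarrow> d \<le> 1 \<Longrightarrow>
      integrable (poisson_pmf r) (\<lambda>k. \<bar>mix_lr r d k - 1\<bar> ^ 3) \<and>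
      measure_pmf.expectation (poisson_pmf r) (\<lambda>k. \<bar>mix_lr r d k - 1\<bar> ^ 3) \<le> C * d ^ 6 * r\<^sup>2"
    using expectation_mix_lr_centered_cube[OF R(1)] by blast
  define E where "E n = measure_pmf.expectation (Pi_pmf {..<N n} 0 (\<lambda>_. poisson_pmf (lam n)))
      (\<lambda>k. min 1 (\<Prod>i<N n. mix_lr (lam n) (d n) (k i)))" for n
  \<comment> \<open>These are the error terms of \<open>expectation_min_le_test_risk\<close> with g
    = \<eta> / 2. The other half of \<eta> pays for the factor 1 - d \<tau> by which the weight may
    lower the Poisson mean.\<close>
  define \<delta> where "\<delta> n = 2 * exp (- ((\<tau> n)\<^sup>2 * real (N n) / 2)) + exp (- (real n * (\<eta> n / 2)\<^sup>2 / 8))" for n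
  have E: "E \<longlonglongrightarrow> 2 * cdf std_normal_distribution (- u_star / 2)"
    unfolding E_def
  proof (rule tendsto_expectation_min_1_prod[OF N_tendsto _ _ _ u_star_pos])
    show "\<forall>\<^sub>F n in sequentially. (\<forall>x. 0 < mix_lr (lam n) (d n) x) \<and>
        integrable (poisson_pmf (lam n)) (mix_lr (lam n) (d n)) \<and>
        measure_pmf.expectation (poisson_pmf (lam n)) (mix_lr (lam n) (d n)) = 1 \<and>
        integrable (poisson_pmf (lam n)) (\<lambda>x. (mix_lr (lam n) (d n) x - 1)\<^sup>2) \<and>
        integrable (poisson_pmf (lam n)) (\<lambda>x. \<bar>mix_lr (lam n) (d n) x - 1\<bar> ^ 3)"
      using lam_pos R(2) d_pos d_less
      by eventually_elim
        (intro conjI allI mix_lr_pos integrable_mix_lr expectation_mix_lr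
          integrable_mix_lr_centered_square C(2)[THEN conjunct1]; simp)
    have "(\<lambda>n. real (N n) * (cosh (b n) - 1)) \<longlonglongrightarrow> 2 * u_star\<^sup>2 / 2"
      by (rule tendsto_mult_cosh_minus_1[OF b0 b_pos Nb2])
    moreover have "\<forall>\<^sub>F n in sequentially. real (N n) * (cosh (b n) - 1) = real (N n) *
        measure_pmf.expectation (poisson_pmf (lam n)) (\<lambda>x. (mix_lr (lam n) (d n) x - 1)\<^sup>2)"
      using lam_pos by eventually_elim (simp add: expectation_mix_lr_centered_square b_def)
    ultimately show "(\<lambda>n. real (N n) *
        measure_pmf.expectation (poisson_pmf (lam n)) (\<lambda>x. (mix_lr (lam n) (d n) x - 1)\<^sup>2)) \<longlonglongrightarrow> u_star\<^sup>2"
      by (auto intro: Lim_transform_eventually)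
    \<comment> \<open>With b = \<lambda> d^2, where \<lambda> is \<open>lam n\<close>, the bound N C
      d^6 \<lambda>^2 equals C (N b^2) d^2; the middle factor converges and \<open>d\<close> tends
      to 0.\<close>
    show "(\<lambda>n. real (N n) *
        measure_pmf.expectation (poisson_pmf (lam n)) (\<lambda>x. \<bar>mix_lr (lam n) (d n) x - 1\<bar> ^ 3)) \<longlonglongrightarrow> 0"
    proof (rule Lim_null_comparison)
      show "\<forall>\<^sub>F n in sequentially. norm (real (N n) *
          measure_pmf.expectation (poisson_pmf (lam n)) (\<lambda>x. \<bar>mix_lr (lam n) (d n) x - 1\<bar> ^ 3))
          \<le> C * (real (N n) * (b n)\<^sup>2 * (d n)\<^sup>2)"
        using lam_pos R(2) d_pos d_less
      proof eventually_elim
        case (elim n)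
        have "measure_pmf.expectation (poisson_pmf (lam n)) (\<lambda>x. \<bar>mix_lr (lam n) (d n) x - 1\<bar> ^ 3)
            \<le> C * d n ^ 6 * (lam n)\<^sup>2"
          using C(2) elim by simp
        from mult_left_mono[OF this, of "real (N n)"]
        have "real (N n) * measure_pmf.expectation (poisson_pmf (lam n)) (\<lambda>x. \<bar>mix_lr (lam n) (d n) x - 1\<bar> ^ 3)
            \<le> real (N n) * (C * d n ^ 6 * (lam n)\<^sup>2)" by simp
        also have "\<dots> = C * (real (N n) * (b n)\<^sup>2 * (d n)\<^sup>2)"
          by (simp add: b_def power_mult_distrib flip: power_mult power_add)
        finally show ?case by simp
      qed
      show "(\<lambda>n. C * (real (N n) * (b n)\<^sup>2 * (d n)\<^sup>2)) \<longlonglongrightarrow> 0"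
        using tendsto_mult_left[OF tendsto_mult[OF Nb2 d2_lim], of C] by simp
    qed
  qed
  have \<delta>0: "\<delta> \<longlonglongrightarrow> 0"
  proof -
    have "filterlim (\<lambda>n. sqrt (real (N n))) at_top sequentially"
      by (rule filterlim_compose[OF sqrt_at_top N'])
    moreover have "((\<lambda>x::real. exp (- (x / 2))) \<longlongrightarrow> 0) at_top" by real_asymp
    ultimately have 1: "(\<lambda>n. exp (- (sqrt (real (N n)) / 2))) \<longlonglongrightarrow> 0"
      by (rule filterlim_compose[rotated])
    have 2: "(\<lambda>n. exp (- (sqrt (real n) / 32))) \<longlonglongrightarrow> 0" by real_asymp
    have lim: "(\<lambda>n. 2 * exp (- (sqrt (real (N n)) / 2)) + exp (- (sqrt (real n) / 32))) \<longlonglongrightarrow> 2 * 0 + 0"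
      by (intro tendsto_intros 1 2)
    have pw: "(x powr (- 1 / 4))\<^sup>2 * x = sqrt x" if "x > 0" for x :: real
    proof -
      have "(x powr (- 1 / 4))\<^sup>2 * x = x powr (- 1 / 4) * x powr (- 1 / 4) * x powr 1"
        using that by (simp add: power2_eq_square)
      also have "\<dots> = x powr (1 / 2)" by (simp only: powr_add[symmetric]) simp
      finally show ?thesis using that by (simp add: powr_half_sqrt)
    qed
    have "\<forall>\<^sub>F n in sequentially. 2 * exp (- (sqrt (real (N n)) / 2)) + exp (- (sqrt (real n) / 32)) = \<delta> n"
      using n1 N1
    proof eventually_elim
      case (elim n)
      then have "(\<tau> n)\<^sup>2 * real (N n) = sqrt (real (N n))" "(\<eta> n)\<^sup>2 * real n = sqrt (real n)"
        unfolding \<tau>_def \<eta>_def by (intro pw; simp)+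
      then show ?case by (simp add: \<delta>_def power_divide mult.commute)
    qed
    with lim show ?thesis by (auto intro: Lim_transform_eventually)
  qed
  \<comment> \<open>The powers of N cancel in (d \<tau>)^2 = K / n, whereas \<eta>^2 = n^(-1/2) is
    of larger order because \<open>K\<close> converges.\<close>
  have small: "\<forall>\<^sub>F n in sequentially. d n * \<tau> n \<le> \<eta> n / 4"
  proof -
    have "(\<lambda>n. K n * real n powr (- 1 / 2)) \<longlonglongrightarrow> sqrt 2 * u_star * 0"
      by (intro tendsto_mult K tendsto_neg_powr[OF _ filterlim_real_sequentially]) simp
    then have "\<forall>\<^sub>F n in sequentially. K n * real n powr (- 1 / 2) < 1 / 16"
      by (intro order_tendstoD(2)) auto
    then show ?thesis
      using n1 N1
    proof eventually_elim
      case (elim n)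
      have sq: "(x powr (- 1 / 4))\<^sup>2 = x powr (- 1 / 2)" if "x > 0" for x :: real
        using that by (simp add: power2_eq_square flip: powr_add)
      have sq\<tau>: "(\<tau> n)\<^sup>2 = real (N n) powr (- 1 / 2)" unfolding \<tau>_def using elim by (intro sq) simp
      have sq\<eta>: "(\<eta> n)\<^sup>2 = real n powr (- 1 / 2)" unfolding \<eta>_def using elim by (intro sq) simp
      have "sqrt (real (N n)) * real (N n) powr (- 1 / 2) = 1"
        using elim by (simp add: powr_half_sqrt[symmetric] flip: powr_add)
      moreover have "(d n * \<tau> n)\<^sup>2 = K n * (sqrt (real (N n)) * real (N n) powr (- 1 / 2)) / real n"
        using elim by (simp add: power_mult_distrib d2 sq\<tau>)
      ultimately have "(d n * \<tau> n)\<^sup>2 = K n / real n" by simp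
      also have "1 / real n = real n powr (- 1 / 2) * real n powr (- 1 / 2)"
        using elim by (simp add: powr_minus_divide flip: powr_add)
      then have "K n / real n = (K n * real n powr (- 1 / 2)) * real n powr (- 1 / 2)"
        by (metis mult.assoc times_divide_eq_right mult.right_neutral)
      also have "\<dots> \<le> 1 / 16 * real n powr (- 1 / 2)"
        using elim by (intro mult_right_mono) auto
      also have "\<dots> = (\<eta> n / 4)\<^sup>2"
        by (simp add: power_divide sq\<eta>)
      finally show ?case by (rule power2_le_imp_le) (simp add: \<eta>_def)
    qed
  qed
  have "\<forall>\<^sub>F n in sequentially. ennreal (E n - \<delta> n) \<le> minimax_risk n (N n) (\<epsilon> n) p"
    using n1 N1 d_pos d_less small
  proof eventually_elim
    case (elim n)
    have N0: "N n > 0" and n0: "n > 0" using elim by auto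
    note \<eta> = \<eta>_bounds[OF elim(1)] and \<tau> = \<tau>_bounds[OF elim(2)]
    have r0: "r n > 0" unfolding r_def using n0 \<eta> by (intro mult_pos_pos) auto
    \<comment> \<open>As 1 + \<eta> \<le> 2, the bound d \<tau> \<le> \<eta> / 4 costs at most half
      of \<eta>.\<close>
    have "1 + \<eta> n / 2 \<le> (1 + \<eta> n) * (1 - d n * \<tau> n)"
    proof -
      have "(1 + \<eta> n) * (d n * \<tau> n) \<le> 2 * (\<eta> n / 4)"
        using \<eta> \<tau> elim by (intro mult_mono) auto
      then show ?thesis by (simp add: algebra_simps)
    qed
    from mult_left_mono[OF this, of "real n"]
    have g: "real n * (1 + \<eta> n / 2) \<le> r n * (1 - d n * \<tau> n)" by (simp add: r_def mult.assoc)
    have "d n * ((1 - \<tau> n) / (1 + \<tau> n)) * real (N n) powr (1 / p - 1)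
        = \<epsilon> n * (real (N n) powr (1 - 1 / p) * real (N n) powr (1 / p - 1))"
      using c_pos[OF elim(2)] by (simp add: d_def flip: c_def)
    also have "\<dots> = \<epsilon> n" using N0 by (simp flip: powr_add)
    finally have eps: "\<epsilon> n \<le> d n * ((1 - \<tau> n) / (1 + \<tau> n)) * real (N n) powr (1 / p - 1)" by simp
    show ?case
    proof (rule ennreal_diff_le_minimax_risk)
      show "ennreal (E n) \<le> test_risk n (N n) (\<epsilon> n) p \<psi> + ennreal (\<delta> n)" if "range \<psi> \<subseteq> {0, 1}" for \<psi>
        unfolding E_def \<delta>_def lam_def
        by (rule expectation_min_le_test_risk) (use N0 n0 r0 elim p_pos \<tau> \<eta> eps_pos eps g that in auto)
      show "\<delta> n \<ge> 0" by (simp add: \<delta>_def)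
    qed
  qed
  then have "liminf (\<lambda>n. ennreal (E n - \<delta> n)) \<le> liminf (\<lambda>n. minimax_risk n (N n) (\<epsilon> n) p)"
    by (rule Liminf_mono)
  moreover have "(\<lambda>n. ennreal (E n - \<delta> n)) \<longlonglongrightarrow> ennreal (2 * cdf std_normal_distribution (- u_star / 2) - 0)"
    by (intro tendsto_ennrealI tendsto_diff E \<delta>0)
  then have "liminf (\<lambda>n. ennreal (E n - \<delta> n)) = ennreal (2 * cdf std_normal_distribution (- u_star / 2))"
    by (intro lim_imp_Liminf) simp_all
  ultimately show ?thesis by simp
qed

end
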